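(* Let $A:H\to H$ be a trace-class operator on a separable Hilbert space, let $\Lambda^{n}(A)$ denote the $n$-th exterior power of $A$, and let $\{\lambda_i\}_{i}$ be the zeros, counted with multiplicity, of the entire function $z\mapsto\det(I-zA)$ (i.e. the reciprocals of the nonzero eigenvalues of $A$). Then for every $$s>\limsup_{n\to+\infty}\frac{n\ln n}{-\ln\left|\operatorname{tr}\left[\Lambda^{n}(A)\right]\right|}$$ we have $\sum_{i}\frac{1}{|\lambda_i|^{s}}<\infty$.
   Context: $\det(I-zA)$ is the Fredholm determinant. In the limsup, terms with $\operatorname{tr}[\Lambda^n(A)]=0$ are interpreted as $0$. *)

theory Defs
  imports "HOL-Complex_Analysis.Complex_Analysis"
    "HOL-Combinatorics.Permutations"
begin

subsection \<open>Complex Hilbert spaces\<close>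

text \<open>The inner product is linear in its second argument. Completeness comes from \<^class>\<open>banach\<close>.\<close>

class complex_hilbert = banach +
  fixes scaleC :: "complex \<Rightarrow> 'a \<Rightarrow> 'a"  (infixr "*\<^sub>C" 75)
    and cinner :: "'a \<Rightarrow> 'a \<Rightarrow> complex"
  assumes scaleC_add_right: "a *\<^sub>C (x + y) = a *\<^sub>C x + a *\<^sub>C y"
    and scaleC_add_left: "(a + b) *\<^sub>C x = a *\<^sub>C x + b *\<^sub>C x"
    and scaleC_scaleC: "a *\<^sub>C (b *\<^sub>C x) = (a * b) *\<^sub>C x"
    and scaleR_eq_scaleC: "r *\<^sub>R x = complex_of_real r *\<^sub>C x"
    and cinner_commute: "cinner x y = cnj (cinner y x)"
    and cinner_add_right: "cinner x (y + z) = cinner x y + cinner x z"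
    and cinner_scaleC_right: "cinner x (a *\<^sub>C y) = a * cinner x y"
    and cinner_self: "cinner x x = complex_of_real ((norm x)\<^sup>2)"

instantiation complex :: complex_hilbert
begin
definition scaleC_complex :: "complex \<Rightarrow> complex \<Rightarrow> complex" where
  "scaleC_complex a z = a * z"
definition cinner_complex :: "complex \<Rightarrow> complex \<Rightarrow> complex" where
  "cinner_complex w z = cnj w * z"
instance
  by standard
    (simp_all add: scaleC_complex_def cinner_complex_def algebra_simps scaleR_conv_of_real
      complex_norm_square del: of_real_power)
end

definition bounded_clinear :: "('a::complex_hilbert \<Rightarrow> 'b::complex_hilbert) \<Rightarrow> bool" where
  "bounded_clinear f \<longleftrightarrow> bounded_linear f \<and> (\<forall>a x. f (a *\<^sub>C x) = a *\<^sub>C f x)"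


subsection \<open>Orthonormal bases and traces\<close>

text \<open>
  The exterior powers below are carrier sets of functions with their own inner product, so bases
  and traces are defined relative to a carrier \<open>K\<close> and an inner product \<open>ip\<close>. An orthonormal basis
  is a maximal orthonormal set. The trace is the diagonal sum in some orthonormal basis;
  for trace-class operators it does not depend on the basis.
\<close>

definition orthonormal :: "'v set \<Rightarrow> ('v \<Rightarrow> 'v \<Rightarrow> complex) \<Rightarrow> 'v set \<Rightarrow> bool" where
  "orthonormal K ip B \<longleftrightarrow> B \<subseteq> K \<and> (\<forall>a\<in>B. \<forall>b\<in>B. ip a b = (if a = b then 1 else 0))"

definition orthonormal_basis :: "'v set \<Rightarrow> ('v \<Rightarrow> 'v \<Rightarrow> complex) \<Rightarrow> 'v set \<Rightarrow> bool" where
  "orthonormal_basis K ip B \<longleftrightarrow>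
     orthonormal K ip B \<and> (\<forall>C. orthonormal K ip C \<and> B \<subseteq> C \<longrightarrow> C = B)"

definition some_basis :: "'v set \<Rightarrow> ('v \<Rightarrow> 'v \<Rightarrow> complex) \<Rightarrow> 'v set" where
  "some_basis K ip = (SOME B. orthonormal_basis K ip B)"

definition op_trace :: "'v set \<Rightarrow> ('v \<Rightarrow> 'v \<Rightarrow> complex) \<Rightarrow> ('v \<Rightarrow> 'v) \<Rightarrow> complex" where
  "op_trace K ip T = (\<Sum>\<^sub>\<infinity>b\<in>some_basis K ip. ip b (T b))"


subsection \<open>Trace-class operators\<close>

text \<open>\<open>P = |A|\<close>: the positive bounded operator with \<open>P\<^sup>2 = A\<^sup>*A\<close> (it is unique).\<close>

definition is_abs_op :: "('a::complex_hilbert \<Rightarrow> 'a) \<Rightarrow> ('a \<Rightarrow> 'a) \<Rightarrow> bool" where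
  "is_abs_op A P \<longleftrightarrow>
     bounded_clinear P \<and>
     (\<forall>x. Im (cinner x (P x)) = 0 \<and> 0 \<le> Re (cinner x (P x))) \<and>
     (\<forall>x y. cinner x (P (P y)) = cinner (A x) (A y))"

text \<open>\<open>A\<close> is trace class if the series defining the trace of \<open>|A|\<close> converges.\<close>

definition trace_class :: "('a::complex_hilbert \<Rightarrow> 'a) \<Rightarrow> bool" where
  "trace_class A \<longleftrightarrow>
     bounded_clinear A \<and>
     (\<exists>P. is_abs_op A P \<and> (\<lambda>e. cinner e (P e)) summable_on some_basis UNIV cinner)"


subsection \<open>Exterior powers of a Hilbert space\<close>

text \<open>
  The Hilbert space \<open>\<Lambda>\<^sup>n(H)\<close> is realised as the space of bounded alternating \<open>n\<close>-linear forms of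
  Hilbert-Schmidt type on the dual \<open>H'\<close>; the vector \<open>x\<^sub>0 \<and> \<dots> \<and> x\<^sub>n\<^sub>-\<^sub>1\<close> is the form
  \<open>(\<phi>\<^sub>0, \<dots>, \<phi>\<^sub>n\<^sub>-\<^sub>1) \<mapsto> det (\<phi>\<^sub>i(x\<^sub>j))\<close>. An \<open>n\<close>-tuple is an extensional function on
  \<open>{..<n}\<close>, and forms are \<open>0\<close> outside the \<open>n\<close>-tuples of functionals.
\<close>

definition dual_tuples :: "nat \<Rightarrow> (nat \<Rightarrow> 'a::complex_hilbert \<Rightarrow> complex) set" where
  "dual_tuples n = {..<n} \<rightarrow>\<^sub>E {\<phi>. bounded_clinear \<phi>}"

definition basis_tuples :: "nat \<Rightarrow> (nat \<Rightarrow> 'a::complex_hilbert) set" where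
  "basis_tuples n = {..<n} \<rightarrow>\<^sub>E some_basis UNIV cinner"

definition riesz :: "nat \<Rightarrow> (nat \<Rightarrow> 'a::complex_hilbert) \<Rightarrow> nat \<Rightarrow> 'a \<Rightarrow> complex" where
  "riesz n e = (\<lambda>i\<in>{..<n}. cinner (e i))"

definition ext_space :: "nat \<Rightarrow> ((nat \<Rightarrow> 'a::complex_hilbert \<Rightarrow> complex) \<Rightarrow> complex) set" where
  "ext_space n = {\<omega>.
     (\<forall>\<phi>. \<phi> \<notin> dual_tuples n \<longrightarrow> \<omega> \<phi> = 0) \<and>
     (\<forall>\<phi>\<in>dual_tuples n. \<forall>i<n. \<forall>f g a b. bounded_clinear f \<and> bounded_clinear g \<longrightarrow>
        \<omega> (\<phi>(i := (\<lambda>x. a * f x + b * g x))) = a * \<omega> (\<phi>(i := f)) + b * \<omega> (\<phi>(i := g))) \<and>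
     (\<forall>\<phi>\<in>dual_tuples n. \<forall>i<n. \<forall>j<n. i \<noteq> j \<and> \<phi> i = \<phi> j \<longrightarrow> \<omega> \<phi> = 0) \<and>
     (\<exists>C. \<forall>\<phi>\<in>dual_tuples n. norm (\<omega> \<phi>) \<le> C * (\<Prod>i<n. onorm (\<phi> i))) \<and>
     (\<lambda>e. (norm (\<omega> (riesz n e)))\<^sup>2) summable_on basis_tuples n}"

text \<open>Normalised so that \<open>\<langle>x\<^sub>0 \<and> \<dots>, y\<^sub>0 \<and> \<dots>\<rangle> = det \<langle>x\<^sub>i, y\<^sub>j\<rangle>\<close>; see \<open>ext_inner_wedge\<close> below.\<close>

definition ext_inner ::
  "nat \<Rightarrow> ((nat \<Rightarrow> 'a::complex_hilbert \<Rightarrow> complex) \<Rightarrow> complex) \<Rightarrow>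
     ((nat \<Rightarrow> 'a \<Rightarrow> complex) \<Rightarrow> complex) \<Rightarrow> complex" where
  "ext_inner n \<omega> \<eta> =
     (\<Sum>\<^sub>\<infinity>e\<in>basis_tuples n. cnj (\<omega> (riesz n e)) * \<eta> (riesz n e)) / fact n"

text \<open>
  \<open>\<Lambda>\<^sup>n(A)\<close>: precomposition with the transpose of \<open>A\<close>, which sends \<open>x\<^sub>0 \<and> \<dots> \<and> x\<^sub>n\<^sub>-\<^sub>1\<close> to
  \<open>A x\<^sub>0 \<and> \<dots> \<and> A x\<^sub>n\<^sub>-\<^sub>1\<close>; see \<open>ext_power_wedge\<close> below.
\<close>

definition ext_power ::
  "nat \<Rightarrow> ('a::complex_hilbert \<Rightarrow> 'a) \<Rightarrow>
     ((nat \<Rightarrow> 'a \<Rightarrow> complex) \<Rightarrow> complex) \<Rightarrow> ((nat \<Rightarrow> 'a \<Rightarrow> complex) \<Rightarrow> complex)" where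
  "ext_power n A \<omega> = (\<lambda>\<phi>. if \<phi> \<in> dual_tuples n then \<omega> (\<lambda>i\<in>{..<n}. \<phi> i \<circ> A) else 0)"

definition ext_trace :: "nat \<Rightarrow> ('a::complex_hilbert \<Rightarrow> 'a) \<Rightarrow> complex" where
  "ext_trace n A = op_trace (ext_space n) (ext_inner n) (ext_power n A)"


subsection \<open>The Fredholm determinant\<close>

text \<open>\<open>det(I + T) = \<Sum>\<^sub>n tr \<Lambda>\<^sup>n(T)\<close> for trace-class \<open>T\<close>.\<close>

definition fredholm_det :: "('a::complex_hilbert \<Rightarrow> 'a) \<Rightarrow> complex" where
  "fredholm_det S = (\<Sum>n. ext_trace n (\<lambda>x. S x - x))"

definition fredholm_fun :: "('a::complex_hilbert \<Rightarrow> 'a) \<Rightarrow> complex \<Rightarrow> complex" where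
  "fredholm_fun A z = fredholm_det (\<lambda>x. x - z *\<^sub>C A x)"

text \<open>Index set of the zeros with multiplicity: a zero of order \<open>m\<close> occurs \<open>m\<close> times.\<close>

definition zeros_with_mult :: "(complex \<Rightarrow> complex) \<Rightarrow> (complex \<times> nat) set" where
  "zeros_with_mult f = (SIGMA z:{z. f z = 0}. {..<nat (zorder f z)})"


subsection \<open>Elementary facts\<close>

lemma cinner_add_left: "cinner (x + y) z = cinner x z + cinner y z"
  for x y z :: "'a::complex_hilbert"
  by (metis cinner_commute cinner_add_right complex_cnj_add)

lemma cinner_scaleC_left: "cinner (a *\<^sub>C x) y = cnj a * cinner x y"
  for x y :: "'a::complex_hilbert"
  by (metis cinner_commute cinner_scaleC_right complex_cnj_mult)

lemma cinner_scaleR_right: "cinner x (r *\<^sub>R y) = of_real r * cinner x y"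
  for x y :: "'a::complex_hilbert"
  by (simp add: scaleR_eq_scaleC cinner_scaleC_right)

lemma cinner_zero_right [simp]: "cinner x 0 = 0" for x :: "'a::complex_hilbert"
  using cinner_add_right[of x 0 0] by simp

lemma cinner_zero_left [simp]: "cinner 0 x = 0" for x :: "'a::complex_hilbert"
  using cinner_add_left[of 0 0 x] by simp

lemma cinner_diff_right: "cinner x (y - z) = cinner x y - cinner x z"
  for x y z :: "'a::complex_hilbert"
  using cinner_add_right[of x "y - z" z] by simp

lemma cinner_diff_left: "cinner (x - y) z = cinner x z - cinner y z"
  for x y z :: "'a::complex_hilbert"
  using cinner_add_left[of "x - y" y z] by simp

lemma cinner_sum_right: "cinner x (sum f F) = (\<Sum>i\<in>F. cinner x (f i))"
  for x :: "'a::complex_hilbert"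
  by (induction F rule: infinite_finite_induct) (simp_all add: cinner_add_right)

lemma cinner_sum_left: "cinner (sum f F) x = (\<Sum>i\<in>F. cinner (f i) x)"
  for x :: "'a::complex_hilbert"
  by (induction F rule: infinite_finite_induct) (simp_all add: cinner_add_left)

lemma cinner_Cauchy_Schwarz: "norm (cinner x y) \<le> norm x * norm y"
  for x y :: "'a::complex_hilbert"
proof (cases "x = 0")
  case False
  define c where "c = cinner x y / of_real ((norm x)\<^sup>2)"
  have nz: "complex_of_real ((norm x)\<^sup>2) \<noteq> 0" using False by simp
  have "complex_of_real ((norm (y - c *\<^sub>C x))\<^sup>2) = cinner (y - c *\<^sub>C x) (y - c *\<^sub>C x)"
    by (simp only: cinner_self)
  also have "\<dots> = cinner y y - c * cinner y x - cnj c * cinner x y + cnj c * c * cinner x x"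
    by (simp add: cinner_diff_left cinner_diff_right cinner_scaleC_left cinner_scaleC_right algebra_simps)
  also have "\<dots> = of_real ((norm y)\<^sup>2) - c * cinner y x"
    using nz by (simp add: cinner_self c_def del: of_real_power)
  also have "c * cinner y x = of_real ((norm (cinner x y))\<^sup>2 / (norm x)\<^sup>2)"
    by (subst cinner_commute[of y x]) (simp only: c_def of_real_divide complex_norm_square times_divide_eq_left)
  finally have "of_real ((norm (y - c *\<^sub>C x))\<^sup>2) =
      complex_of_real ((norm y)\<^sup>2 - (norm (cinner x y))\<^sup>2 / (norm x)\<^sup>2)"
    by simp
  then have "(norm (y - c *\<^sub>C x))\<^sup>2 = (norm y)\<^sup>2 - (norm (cinner x y))\<^sup>2 / (norm x)\<^sup>2"
    using of_real_eq_iff by blast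
  then have "(norm (cinner x y))\<^sup>2 / (norm x)\<^sup>2 \<le> (norm y)\<^sup>2"
    by (smt (verit) zero_le_power2)
  then have "(norm (cinner x y))\<^sup>2 \<le> (norm x * norm y)\<^sup>2"
    using False by (simp add: field_simps power_mult_distrib)
  then show ?thesis
    by (rule power2_le_imp_le) simp
qed simp

lemma bounded_clinear_cinner: "bounded_clinear (cinner x)"
  for x :: "'a::complex_hilbert"
  unfolding bounded_clinear_def
proof (intro conjI allI)
  show "bounded_linear (cinner x)"
    by (rule bounded_linear_intro[where K = "norm x"])
      (simp_all add: cinner_add_right cinner_scaleR_right scaleR_conv_of_real
        cinner_Cauchy_Schwarz mult.commute[of "norm _" "norm x"])
qed (simp add: cinner_scaleC_right scaleC_complex_def)

lemma bounded_linear_cinner: "bounded_linear (cinner x)"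
  for x :: "'a::complex_hilbert"
  using bounded_clinear_cinner[of x] by (simp add: bounded_clinear_def)

lemma bounded_clinear_compose:
  "bounded_clinear f \<Longrightarrow> bounded_clinear g \<Longrightarrow> bounded_clinear (f \<circ> g)"
  unfolding bounded_clinear_def by (auto intro: bounded_linear_compose simp: o_def)

lemma exists_orthonormal_basis: "\<exists>B. orthonormal_basis K ip B"
proof -
  have "\<exists>M\<in>{B. orthonormal K ip B}. \<forall>X\<in>{B. orthonormal K ip B}. M \<subseteq> X \<longrightarrow> X = M"
  proof (rule subset_Zorn')
    fix C assume C: "subset.chain {B. orthonormal K ip B} C"
    have "orthonormal K ip (\<Union>C)"
      unfolding orthonormal_def
    proof (intro conjI ballI)
      show "\<Union>C \<subseteq> K"
        using C by (auto simp: subset.chain_def orthonormal_def)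
      fix a b assume "a \<in> \<Union>C" "b \<in> \<Union>C"
      then obtain X Y where XY: "X \<in> C" "Y \<in> C" "a \<in> X" "b \<in> Y" by blast
      then have "X \<subseteq> Y \<or> Y \<subseteq> X"
        using C by (auto simp: subset_chain_def)
      then obtain Z where "Z \<in> C" "a \<in> Z" "b \<in> Z" using XY by blast
      moreover have "orthonormal K ip Z"
        using C \<open>Z \<in> C\<close> by (auto simp: subset.chain_def)
      ultimately show "ip a b = (if a = b then 1 else 0)"
        by (simp add: orthonormal_def)
    qed
    then show "\<Union>C \<in> {B. orthonormal K ip B}" by simp
  qed
  then show ?thesis unfolding orthonormal_basis_def by auto
qed

lemma orthonormal_basis_some: "orthonormal_basis K ip (some_basis K ip)"
  unfolding some_basis_def by (rule someI_ex) (rule exists_orthonormal_basis)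


lemma has_sum_finite_sum:
  fixes f :: "'i \<Rightarrow> 'b \<Rightarrow> complex"
  assumes "finite I" "\<And>i. i \<in> I \<Longrightarrow> (f i has_sum s i) A"
  shows "((\<lambda>x. \<Sum>i\<in>I. f i x) has_sum (\<Sum>i\<in>I. s i)) A"
  using assms by (induction I) (auto intro!: has_sum_add)


subsection \<open>Parseval's identity\<close>

lemma norm_sum_orthonormal:
  fixes c :: "'a::complex_hilbert \<Rightarrow> complex"
  assumes "orthonormal UNIV cinner B" "F \<subseteq> B" "finite F"
  shows "(norm (\<Sum>e\<in>F. c e *\<^sub>C e))\<^sup>2 = (\<Sum>e\<in>F. (norm (c e))\<^sup>2)"
proof -
  have "complex_of_real ((norm (\<Sum>e\<in>F. c e *\<^sub>C e))\<^sup>2) =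
      (\<Sum>d\<in>F. \<Sum>e\<in>F. cnj (c d) * (c e * cinner d e))"
    by (subst cinner_self[symmetric])
      (simp add: cinner_sum_left cinner_sum_right cinner_scaleC_left cinner_scaleC_right
        sum_distrib_left, subst sum.swap, simp add: mult_ac)
  also have "\<dots> = (\<Sum>d\<in>F. \<Sum>e\<in>F. if d = e then cnj (c d) * c d else 0)"
    using assms by (intro sum.cong refl) (auto simp: orthonormal_def subset_iff)
  also have "\<dots> = (\<Sum>d\<in>F. cnj (c d) * c d)"
    using assms(3) by (simp add: sum.delta)
  also have "\<dots> = complex_of_real (\<Sum>e\<in>F. (norm (c e))\<^sup>2)"
    unfolding of_real_sum complex_norm_square by (simp add: mult.commute)
  finally show ?thesis using of_real_eq_iff by blast
qed

lemma Bessel: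
  fixes x :: "'a::complex_hilbert"
  assumes "orthonormal UNIV cinner B" "F \<subseteq> B" "finite F"
  shows "(\<Sum>e\<in>F. (norm (cinner e x))\<^sup>2) \<le> (norm x)\<^sup>2"
proof -
  define u where "u = (\<Sum>e\<in>F. cinner e x *\<^sub>C e)"
  have u: "(norm u)\<^sup>2 = (\<Sum>e\<in>F. (norm (cinner e x))\<^sup>2)"
    unfolding u_def by (rule norm_sum_orthonormal[OF assms])
  have ux: "cinner u x = of_real ((norm u)\<^sup>2)"
    unfolding u of_real_sum complex_norm_square
    by (simp add: u_def cinner_sum_left cinner_scaleC_left mult.commute)
  have xu: "cinner x u = of_real ((norm u)\<^sup>2)"
    by (subst cinner_commute) (simp add: ux)
  have "complex_of_real ((norm (x - u))\<^sup>2) = cinner (x - u) (x - u)"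
    by (simp only: cinner_self)
  also have "\<dots> = of_real ((norm x)\<^sup>2 - (norm u)\<^sup>2)"
    by (simp only: cinner_diff_left cinner_diff_right ux xu) (simp add: cinner_self)
  finally have "(norm (x - u))\<^sup>2 = (norm x)\<^sup>2 - (norm u)\<^sup>2"
    using of_real_eq_iff by blast
  then show ?thesis using u by (smt (verit) zero_le_power2)
qed

lemma summable_coeffs:
  fixes x :: "'a::complex_hilbert"
  assumes "orthonormal UNIV cinner B"
  shows "(\<lambda>e. (norm (cinner e x))\<^sup>2) summable_on B"
  by (rule nonneg_bdd_above_summable_on)
    (auto simp: bdd_above_def intro!: exI[of _ "(norm x)\<^sup>2"] Bessel[OF assms])

lemma summable_expansion:
  fixes x :: "'a::complex_hilbert"
  assumes on: "orthonormal UNIV cinner B"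
  shows "(\<lambda>e. cinner e x *\<^sub>C e) summable_on B"
proof -
  let ?g = "\<lambda>e. (norm (cinner e x))\<^sup>2" and ?f = "\<lambda>e. cinner e x *\<^sub>C e"
  obtain L where lim: "(sum ?g \<longlongrightarrow> L) (finite_subsets_at_top B)"
    using summable_coeffs[OF on] unfolding has_sum_def summable_on_def by blast
  have "\<exists>P. eventually P (finite_subsets_at_top B) \<and>
      (\<forall>F F'. P F \<and> P F' \<longrightarrow> dist (sum ?f F) (sum ?f F') < r)" if "r > 0" for r
  proof -
    define d where "d = (r / 2)\<^sup>2"
    have "d > 0" using that by (simp add: d_def)
    then have "\<forall>\<^sub>F F in finite_subsets_at_top B. dist (sum ?g F) L < d / 2"
      by (intro tendstoD[OF lim]) simp
    then obtain F0 where F0: "finite F0" "F0 \<subseteq> B"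
      and F0': "\<And>F. finite F \<Longrightarrow> F0 \<subseteq> F \<Longrightarrow> F \<subseteq> B \<Longrightarrow> dist (sum ?g F) L < d / 2"
      unfolding eventually_finite_subsets_at_top by auto
    have close: "dist (sum ?f F) (sum ?f F0) < r / 2" if F: "finite F" "F0 \<subseteq> F" "F \<subseteq> B" for F
    proof -
      have "(dist (sum ?f F) (sum ?f F0))\<^sup>2 = (norm (sum ?f (F - F0)))\<^sup>2"
        using F by (simp add: dist_norm sum_diff)
      also have "\<dots> = sum ?g (F - F0)"
        using F by (intro norm_sum_orthonormal[OF on]) auto
      also have "\<dots> = sum ?g F - sum ?g F0"
        using F by (simp add: sum_diff)
      also have "\<dots> < d"
        using F0'[OF F] F0'[of F0] F0 by (auto simp: dist_real_def abs_if split: if_splits)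
      finally show ?thesis
        unfolding d_def by (rule power2_less_imp_less) (use \<open>r > 0\<close> in simp)
    qed
    show ?thesis
    proof (intro exI conjI allI impI)
      show "eventually (\<lambda>F. finite F \<and> F0 \<subseteq> F \<and> F \<subseteq> B) (finite_subsets_at_top B)"
        using F0 unfolding eventually_finite_subsets_at_top by blast
      fix F F' assume "(finite F \<and> F0 \<subseteq> F \<and> F \<subseteq> B) \<and> finite F' \<and> F0 \<subseteq> F' \<and> F' \<subseteq> B"
      then have "dist (sum ?f F) (sum ?f F0) < r / 2" "dist (sum ?f F') (sum ?f F0) < r / 2"
        using close by blast+
      then show "dist (sum ?f F) (sum ?f F') < r"
        by (rule dist_triangle_half_l)
    qed
  qed
  then have "cauchy_filter (filtermap (sum ?f) (finite_subsets_at_top B))"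
    by (simp add: cauchy_filter_metric_filtermap)
  moreover have "complete (UNIV :: 'a set)"
    by (meson Cauchy_convergent UNIV_I complete_def convergent_def)
  ultimately obtain L' where "(sum ?f \<longlongrightarrow> L') (finite_subsets_at_top B)"
    using complete_uniform[where S = UNIV] by (force simp add: filterlim_def)
  then show ?thesis
    using summable_on_def has_sum_def by blast
qed

lemma basis_expansion:
  fixes x :: "'a::complex_hilbert"
  assumes B: "orthonormal_basis UNIV cinner B"
  shows "((\<lambda>e. cinner e x *\<^sub>C e) has_sum x) B"
proof -
  have on: "orthonormal UNIV cinner B"
    using B by (simp add: orthonormal_basis_def)
  obtain u where u: "((\<lambda>e. cinner e x *\<^sub>C e) has_sum u) B"
    using summable_expansion[OF on] by (auto simp: summable_on_def)
  have coeff: "cinner b u = cinner b x" if "b \<in> B" for b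
  proof -
    have "((\<lambda>e. cinner b (cinner e x *\<^sub>C e)) has_sum cinner b u) B"
      by (rule has_sum_bounded_linear[OF bounded_linear_cinner u])
    moreover have "((\<lambda>e. cinner b (cinner e x *\<^sub>C e)) has_sum cinner b x) B"
    proof (rule has_sum_finite_neutralI)
      show "finite {b}" "{b} \<subseteq> B" using that by auto
      show "cinner b (cinner e x *\<^sub>C e) = 0" if "e \<in> B - {b}" for e
        using on \<open>b \<in> B\<close> that by (auto simp: orthonormal_def cinner_scaleC_right)
      show "cinner b x = (\<Sum>e\<in>{b}. cinner b (cinner e x *\<^sub>C e))"
        using on \<open>b \<in> B\<close> by (simp add: orthonormal_def cinner_scaleC_right)
    qed
    ultimately show ?thesis using has_sum_unique by blast
  qed
  have "x - u = 0"
  proof (rule ccontr)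
    assume nz: "x - u \<noteq> 0"
    define w where "w = (1 / norm (x - u)) *\<^sub>R (x - u)"
    have "norm w = 1" using nz by (simp add: w_def)
    then have ww: "cinner w w = 1" by (simp add: cinner_self)
    have bw: "cinner b w = 0" if "b \<in> B" for b
      using coeff[OF that] by (simp add: w_def cinner_scaleR_right cinner_diff_right)
    have wb: "cinner w b = 0" if "b \<in> B" for b
      using bw[OF that] by (subst cinner_commute) simp
    have "w \<notin> B" using bw ww by force
    have "orthonormal UNIV cinner (insert w B)"
      using on bw wb ww \<open>w \<notin> B\<close> unfolding orthonormal_def by auto
    then have "insert w B = B"
      using B unfolding orthonormal_basis_def by blast
    then show False using \<open>w \<notin> B\<close> by blast
  qed
  then show ?thesis using u by simp
qed

lemma Parseval:
  fixes x y :: "'a::complex_hilbert"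
  assumes "orthonormal_basis UNIV cinner B"
  shows "((\<lambda>e. cinner x e * cinner e y) has_sum cinner x y) B"
  using has_sum_bounded_linear[OF bounded_linear_cinner[of x] basis_expansion[OF assms, of y]]
  by (simp add: cinner_scaleC_right mult.commute)

lemma has_sum_prod_PiE:
  fixes f :: "'i \<Rightarrow> 'b \<Rightarrow> complex"
  assumes I: "finite I" and f: "\<And>i. i \<in> I \<Longrightarrow> (f i has_sum s i) (B i)"
  shows "((\<lambda>g. \<Prod>i\<in>I. f i (g i)) has_sum (\<Prod>i\<in>I. s i)) (PiE I B)"
proof -
  have abs: "(\<lambda>b. norm (f i b)) summable_on B i" if "i \<in> I" for i
    using f[OF that] summable_on_iff_abs_summable_on_complex summable_on_def by blast
  have "(\<lambda>g. \<Prod>i\<in>I. norm (f i (g i))) summable_on PiE I B"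
  proof (rule nonneg_bdd_above_summable_on)
    show "bdd_above (sum (\<lambda>g. \<Prod>i\<in>I. norm (f i (g i))) ` {F. F \<subseteq> PiE I B \<and> finite F})"
    proof (rule bdd_aboveI2)
      fix F assume "F \<in> {F. F \<subseteq> PiE I B \<and> finite F}"
      then have F: "F \<subseteq> PiE I B" "finite F" by auto
      let ?B = "\<lambda>i. (\<lambda>g. g i) ` F"
      have sub: "F \<subseteq> PiE I ?B"
        using F(1) by (auto simp: PiE_iff)
      have "(\<Sum>g\<in>F. \<Prod>i\<in>I. norm (f i (g i))) \<le> (\<Sum>g\<in>PiE I ?B. \<Prod>i\<in>I. norm (f i (g i)))"
        by (rule sum_mono2) (use sub F I in \<open>auto intro!: finite_PiE prod_nonneg\<close>)
      also have "\<dots> = (\<Prod>i\<in>I. \<Sum>b\<in>?B i. norm (f i b))"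
        using F I by (subst prod_sum_PiE) auto
      also have "\<dots> \<le> (\<Prod>i\<in>I. \<Sum>\<^sub>\<infinity>b\<in>B i. norm (f i b))"
      proof (rule prod_mono)
        fix i assume "i \<in> I"
        then have "?B i \<subseteq> B i" using F(1) by (auto simp: PiE_iff)
        then show "0 \<le> (\<Sum>b\<in>?B i. norm (f i b)) \<and>
            (\<Sum>b\<in>?B i. norm (f i b)) \<le> (\<Sum>\<^sub>\<infinity>b\<in>B i. norm (f i b))"
          using F(2) abs[OF \<open>i \<in> I\<close>]
          by (intro conjI sum_nonneg finite_sum_le_infsum) auto
      qed
      finally show "(\<Sum>g\<in>F. \<Prod>i\<in>I. norm (f i (g i))) \<le> (\<Prod>i\<in>I. \<Sum>\<^sub>\<infinity>b\<in>B i. norm (f i b))" .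
    qed
  qed (auto intro: prod_nonneg)
  then have "(\<lambda>g. \<Prod>i\<in>I. f i (g i)) summable_on PiE I B"
    unfolding prod_norm by (rule abs_summable_summable)
  moreover have "infsum (\<lambda>g. \<Prod>i\<in>I. f i (g i)) (PiE I B) = (\<Prod>i\<in>I. s i)"
    using infsum_prod_PiE_abs[OF I abs] infsumI[OF f] by (simp cong: prod.cong)
  ultimately show ?thesis
    using has_sum_infsum by metis
qed


subsection \<open>Wedge products and the characteristic identities of the exterior power\<close>

definition wedge ::
  "nat \<Rightarrow> (nat \<Rightarrow> 'a::complex_hilbert) \<Rightarrow> (nat \<Rightarrow> 'a \<Rightarrow> complex) \<Rightarrow> complex" where
  "wedge n x = (\<lambda>\<phi>. if \<phi> \<in> dual_tuples n
     then \<Sum>p | p permutes {..<n}. of_int (sign p) * (\<Prod>i<n. \<phi> i (x (p i))) else 0)"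

lemma riesz_in_dual_tuples: "riesz n e \<in> dual_tuples n"
  by (simp add: riesz_def dual_tuples_def bounded_clinear_cinner)

theorem ext_power_wedge:
  assumes "bounded_clinear A"
  shows "ext_power n A (wedge n x) = wedge n (\<lambda>i. A (x i))"
proof
  fix \<phi>
  show "ext_power n A (wedge n x) \<phi> = wedge n (\<lambda>i. A (x i)) \<phi>"
  proof (cases "\<phi> \<in> dual_tuples n")
    case True
    then have "(\<lambda>i\<in>{..<n}. \<phi> i \<circ> A) \<in> dual_tuples n"
      using assms by (auto simp: dual_tuples_def PiE_iff intro: bounded_clinear_compose)
    with True show ?thesis
      by (simp add: ext_power_def wedge_def)
  qed (simp add: ext_power_def wedge_def)
qed

lemma has_sum_wedge:
  "((\<lambda>e. cnj (wedge n x (riesz n e)) * wedge n y (riesz n e)) has_sum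
     fact n * (\<Sum>p | p permutes {..<n}. of_int (sign p) * (\<Prod>i<n. cinner (x i) (y (p i)))))
   (basis_tuples n)"
proof -
  let ?S = "{p. p permutes {..<n}}" and ?B = "some_basis UNIV (cinner :: 'a \<Rightarrow> _)"
  let ?c = "\<lambda>p q. of_int (sign p) * of_int (sign q) :: complex"
  have fin: "finite ?S" by (simp add: finite_permutations)
  have w: "wedge n z (riesz n e) =
      (\<Sum>p\<in>?S. of_int (sign p) * (\<Prod>i<n. cinner (e i) (z (p i))))" for z e :: "nat \<Rightarrow> 'a"
    using riesz_in_dual_tuples[of n e] by (simp add: wedge_def) (simp add: riesz_def)
  have "((\<lambda>e. \<Sum>p\<in>?S. \<Sum>q\<in>?S. ?c p q *
          (\<Prod>i<n. cinner (x (p i)) (e i) * cinner (e i) (y (q i))))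
        has_sum (\<Sum>p\<in>?S. \<Sum>q\<in>?S. ?c p q * (\<Prod>i<n. cinner (x (p i)) (y (q i)))))
      (basis_tuples n)"
    unfolding basis_tuples_def
    by (rule has_sum_finite_sum[OF fin])+
      (rule has_sum_cmult_right, rule has_sum_prod_PiE[OF finite_lessThan],
        rule Parseval[OF orthonormal_basis_some])
  moreover have "(\<Sum>p\<in>?S. \<Sum>q\<in>?S. ?c p q *
        (\<Prod>i<n. cinner (x (p i)) (e i) * cinner (e i) (y (q i)))) =
      cnj (wedge n x (riesz n e)) * wedge n y (riesz n e)" for e
    unfolding w cnj_sum sum_product
    by (intro sum.cong refl)
      (simp add: prod.distrib mult_ac flip: cinner_commute)
  moreover have "(\<Sum>q\<in>?S. ?c p q * (\<Prod>i<n. cinner (x (p i)) (y (q i)))) =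
      (\<Sum>q\<in>?S. of_int (sign q) * (\<Prod>i<n. cinner (x i) (y (q i))))"
    (is "?l = ?r") if p: "p \<in> ?S" for p
  proof -
    have p': "p permutes {..<n}" using p by simp
    have "?r = (\<Sum>q\<in>?S. of_int (sign (q \<circ> inv p)) *
        (\<Prod>i<n. cinner (x i) (y ((q \<circ> inv p) i))))"
      by (rule sum.reindex_bij_betw[symmetric, of "\<lambda>q. q \<circ> inv p"])
        (rule bij_betw_byWitness[where f' = "\<lambda>q. q \<circ> p"],
          use p' in \<open>auto simp: o_assoc[symmetric] permutes_inv_o permutes_compose permutes_inv\<close>)
    also have "\<dots> = ?l"
    proof (rule sum.cong[OF refl])
      fix q assume "q \<in> ?S"
      then have q: "q permutes {..<n}" by simp
      have "permutation p" "permutation q"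
        using p' q by (auto simp: permutation_permutes)
      then have "sign (q \<circ> inv p) = sign p * sign q"
        by (simp add: sign_compose sign_inverse permutation_inverse)
      moreover have "(\<Prod>i<n. cinner (x i) (y ((q \<circ> inv p) i))) =
          (\<Prod>i<n. cinner (x (p i)) (y (q i)))"
        by (subst prod.permute[OF p']) (simp add: o_def permutes_inverses[OF p'])
      ultimately show "of_int (sign (q \<circ> inv p)) *
            (\<Prod>i<n. cinner (x i) (y ((q \<circ> inv p) i))) =
          ?c p q * (\<Prod>i<n. cinner (x (p i)) (y (q i)))"
        by simp
    qed
    finally show ?thesis by simp
  qed
  ultimately have "((\<lambda>e. cnj (wedge n x (riesz n e)) * wedge n y (riesz n e)) has_sum
      (\<Sum>p\<in>?S. \<Sum>q\<in>?S. of_int (sign q) * (\<Prod>i<n. cinner (x i) (y (q i))))) (basis_tuples n)"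
    by simp
  then show ?thesis
    by (simp add: card_permutations)
qed

theorem ext_inner_wedge:
  "ext_inner n (wedge n x) (wedge n y) =
     (\<Sum>p | p permutes {..<n}. of_int (sign p) * (\<Prod>i<n. cinner (x i) (y (p i))))"
  using infsumI[OF has_sum_wedge[of n x y]] by (simp add: ext_inner_def)

theorem wedge_in_ext_space: "wedge n x \<in> ext_space n"
proof -
  let ?S = "{p. p permutes {..<n}}"
  have upd: "\<phi>(i := f) \<in> dual_tuples n"
    if "\<phi> \<in> dual_tuples n" "i < n" "bounded_clinear f"
    for \<phi> :: "nat \<Rightarrow> 'a \<Rightarrow> complex" and i f
    using that by (auto simp: dual_tuples_def PiE_iff extensional_def)
  have comb: "bounded_clinear (\<lambda>z. a * f z + b * g z)"
    if "bounded_clinear f" "bounded_clinear g" for f g :: "'a \<Rightarrow> complex" and a b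
    using that unfolding bounded_clinear_def
    by (auto intro!: bounded_linear_add bounded_linear_const_mult
        simp: scaleC_complex_def algebra_simps)
  have prod_upd: "(\<Prod>j<n. (\<phi>(i := h)) j (z j)) = h (z i) * (\<Prod>j\<in>{..<n} - {i}. \<phi> j (z j))"
    if "i < n" for \<phi> :: "nat \<Rightarrow> 'a \<Rightarrow> complex" and i h z
    using that by (subst prod.remove[of _ i]) auto
  have multilinear: "wedge n x (\<phi>(i := (\<lambda>z. a * f z + b * g z))) =
      a * wedge n x (\<phi>(i := f)) + b * wedge n x (\<phi>(i := g))"
    if "\<phi> \<in> dual_tuples n" "i < n" "bounded_clinear f" "bounded_clinear g" for \<phi> i f g a b
    using that
    by (simp add: wedge_def upd comb prod_upd sum_distrib_left algebra_simps
        flip: sum.distrib del: fun_upd_apply)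
  have alternating: "wedge n x \<phi> = 0"
    if \<phi>: "\<phi> \<in> dual_tuples n" and ij: "i < n" "j < n" "i \<noteq> j" "\<phi> i = \<phi> j" for \<phi> i j
  proof -
    let ?t = "Transposition.transpose i j"
    have t: "?t permutes {..<n}" using ij by (intro permutes_swap_id) auto
    have "wedge n x \<phi> = (\<Sum>p\<in>?S. of_int (sign p) * (\<Prod>k<n. \<phi> k (x (p k))))"
      using \<phi> by (simp add: wedge_def)
    also have "\<dots> = (\<Sum>p\<in>?S. of_int (sign (p \<circ> ?t)) * (\<Prod>k<n. \<phi> k (x ((p \<circ> ?t) k))))"
      by (rule sum.reindex_bij_betw[symmetric, of "\<lambda>p. p \<circ> ?t"])
        (rule bij_betw_byWitness[where f' = "\<lambda>p. p \<circ> ?t"],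
          use t in \<open>auto simp: o_assoc[symmetric] permutes_compose\<close>)
    also have "\<dots> = (\<Sum>p\<in>?S. - (of_int (sign p) * (\<Prod>k<n. \<phi> k (x (p k)))))"
    proof (rule sum.cong[OF refl])
      fix p assume "p \<in> ?S"
      then have p: "permutation p" by (auto simp: permutation_permutes)
      have "sign (p \<circ> ?t) = - sign p"
        using p ij by (simp add: sign_compose permutation_swap_id sign_swap_id)
      moreover have "(\<Prod>k<n. \<phi> k (x ((p \<circ> ?t) k))) = (\<Prod>k<n. \<phi> (?t k) (x (p k)))"
        by (subst prod.permute[OF t]) (simp add: o_def)
      moreover have "\<phi> (?t k) = \<phi> k" for k
        using ij by (auto simp: Transposition.transpose_def)
      ultimately show "of_int (sign (p \<circ> ?t)) * (\<Prod>k<n. \<phi> k (x ((p \<circ> ?t) k))) =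
          - (of_int (sign p) * (\<Prod>k<n. \<phi> k (x (p k))))"
        by simp
    qed
    also have "\<dots> = - wedge n x \<phi>"
      using \<phi> by (simp add: wedge_def sum_negf)
    finally show ?thesis by simp
  qed
  have bounded: "norm (wedge n x \<phi>) \<le> (\<Sum>p\<in>?S. \<Prod>i<n. norm (x (p i))) * (\<Prod>i<n. onorm (\<phi> i))"
    if \<phi>: "\<phi> \<in> dual_tuples n" for \<phi>
  proof -
    have bl: "bounded_linear (\<phi> i)" if "i < n" for i
      using \<phi> that by (auto simp: dual_tuples_def PiE_iff bounded_clinear_def)
    have "norm (wedge n x \<phi>) \<le> (\<Sum>p\<in>?S. norm (of_int (sign p) * (\<Prod>i<n. \<phi> i (x (p i)))))"
      using \<phi> by (simp add: wedge_def norm_sum)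
    also have "\<dots> \<le> (\<Sum>p\<in>?S. \<Prod>i<n. onorm (\<phi> i) * norm (x (p i)))"
    proof (rule sum_mono)
      fix p assume "p \<in> ?S"
      have "norm (of_int (sign p) :: complex) = 1" by (simp add: sign_def)
      then have "norm (of_int (sign p) * (\<Prod>i<n. \<phi> i (x (p i)))) =
          (\<Prod>i<n. norm (\<phi> i (x (p i))))"
        unfolding norm_mult prod_norm by simp
      also have "\<dots> \<le> (\<Prod>i<n. onorm (\<phi> i) * norm (x (p i)))"
        by (rule prod_mono) (auto intro: onorm bl)
      finally show "norm (of_int (sign p) * (\<Prod>i<n. \<phi> i (x (p i)))) \<le> \<dots>" .
    qed
    also have "\<dots> = (\<Sum>p\<in>?S. \<Prod>i<n. norm (x (p i))) * (\<Prod>i<n. onorm (\<phi> i))"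
      by (simp add: prod.distrib sum_distrib_left mult.commute)
    finally show ?thesis .
  qed
  have "(\<lambda>e. Re (cnj (wedge n x (riesz n e)) * wedge n x (riesz n e))) summable_on basis_tuples n"
    using has_sum_wedge[of n x x] by (intro summable_on_Re) (auto simp: summable_on_def)
  then have "(\<lambda>e. (norm (wedge n x (riesz n e)))\<^sup>2) summable_on basis_tuples n"
    unfolding cmod_power2 by (simp add: power2_eq_square)
  then show ?thesis
    unfolding ext_space_def using multilinear alternating bounded
    by (auto simp: wedge_def[of n x] intro!: exI[of _ "\<Sum>p\<in>?S. \<Prod>i<n. norm (x (p i))"])
qed

end

theory Submission
  imports Defs
begin

text \<open>
  Since \<open>tr \<Lambda>\<^sup>n(-zA) = (-z)\<^sup>n tr \<Lambda>\<^sup>n(A)\<close>, the Fredholm function is the power series with coefficients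
  \<open>a\<^sub>n = (-1)\<^sup>n tr \<Lambda>\<^sup>n(A)\<close>. Once \<open>a\<^sub>n\<close> is known to tend to \<open>0\<close>, the limsup hypothesis says that
  \<open>\<bar>a\<^sub>n\<bar> \<le> n powr (-n/\<rho>)\<close> eventually for some \<open>0 < \<rho> < s\<close>, so the function is entire of order at
  most \<open>\<rho>\<close>; comparing it with the product over its zeros bounds their number in a disc of
  radius \<open>r\<close> by \<open>O(r powr \<rho>')\<close> for \<open>\<rho> < \<rho>' < s\<close>, and a dyadic summation finishes the proof.

  That \<open>a\<^sub>n\<close> tends to \<open>0\<close> uses trace class. A Cholesky decomposition of \<open>\<bar>A\<bar>\<close> along an orthonormal
  basis needs neither the spectral theorem nor the polar decomposition, and writes \<open>A\<close> as a
  norm-convergent series \<open>\<Sum>\<^sub>k \<langle>w\<^sub>k, \<cdot>\<rangle> u\<^sub>k\<close> with \<open>\<parallel>u\<^sub>k\<parallel> = \<parallel>w\<^sub>k\<parallel>\<close> and \<open>\<Sum>\<^sub>k \<parallel>w\<^sub>k\<parallel>\<^sup>2 < \<infinity>\<close>.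
  Expanding the trace of \<open>\<Lambda>\<^sup>n(A)\<close> multilinearly, Bessel's inequality bounds it by
  the sum of \<open>\<Prod>\<^sub>i \<parallel>w (\<kappa> i)\<parallel>\<^sup>2\<close> over injective \<open>n\<close>-tuples of indices, and this sum decays geometrically
  because only finitely many of the weights are not small.
\<close>

subsection \<open>Zeros of entire functions of finite order\<close>

text \<open>The singularity of the quotient at \<open>a\<close> is removable: near \<open>a\<close>
  the quotient agrees with \<open>zor_poly\<close>. The point \<open>w\<close> excludes the zero
  function, which has no order at \<open>a\<close>.\<close>

lemma entire_factor_at:
  fixes f :: "complex \<Rightarrow> complex"
  assumes f: "f holomorphic_on UNIV" and nz: "f w \<noteq> 0"
  obtains h where "h holomorphic_on UNIV" "\<And>z. f z = h z * (z - a) ^ nat (zorder f a)" "h a \<noteq> 0"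
proof -
  define m where "m = nat (zorder f a)"
  obtain r where r: "r > 0" "zor_poly f a holomorphic_on cball a r"
    "\<And>z. z \<in> cball a r \<Longrightarrow> f z = zor_poly f a z * (z - a) ^ m \<and> zor_poly f a z \<noteq> 0"
  proof -
    have "\<exists>w\<in>UNIV. f w \<noteq> 0" using nz by blast
    from zorder_exist_zero[OF f open_UNIV connected_UNIV UNIV_I this, of a] show ?thesis
      using that unfolding m_def by blast
  qed
  define h where "h z = (if z = a then zor_poly f a a else f z / (z - a) ^ m)" for z
  have h_local: "h z = zor_poly f a z" if "z \<in> ball a r" for z
    using r(3)[of z] that by (auto simp: h_def)
  have "h holomorphic_on ball a r"
    by (subst holomorphic_cong[OF refl h_local])
      (use r(2) in \<open>auto intro: holomorphic_on_subset\<close>)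
  moreover have "h holomorphic_on (- {a})"
  proof -
    have "(\<lambda>z. f z / (z - a) ^ m) holomorphic_on (- {a})"
      by (intro holomorphic_intros holomorphic_on_subset[OF f]) auto
    then show ?thesis
      by (rule holomorphic_transform) (simp add: h_def)
  qed
  ultimately have "h holomorphic_on (ball a r \<union> - {a})"
    by (intro holomorphic_on_Un) auto
  moreover have "ball a r \<union> - {a} = UNIV"
    using r(1) by auto
  moreover have "f z = h z * (z - a) ^ m" for z
    using r(3)[of a] r(1) by (auto simp: h_def)
  moreover have "h a \<noteq> 0"
    using r(3)[of a] r(1) by (simp add: h_def)
  ultimately show ?thesis
    using that unfolding m_def by auto
qed

text \<open>The zeros are divided out one after another. The factors removed so far do not vanish at
  a new point \<open>b\<close>, so the current quotient has the same order there as
  \<open>f\<close>.\<close>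

lemma entire_factor:
  fixes f :: "complex \<Rightarrow> complex"
  assumes f: "f holomorphic_on UNIV" and nz: "f w \<noteq> 0" and "finite F"
  shows "\<exists>g. g holomorphic_on UNIV \<and> (\<forall>z. f z = g z * (\<Prod>a\<in>F. (z - a) ^ nat (zorder f a)))"
  using \<open>finite F\<close>
proof (induction F)
  case empty
  then show ?case using f by auto
next
  case (insert b F)
  define p where "p z = (\<Prod>a\<in>F. (z - a) ^ nat (zorder f a))" for z
  obtain g where g: "g holomorphic_on UNIV" "\<And>z. f z = g z * p z"
    using insert.IH unfolding p_def by blast
  have gw: "g w \<noteq> 0" using nz g(2)[of w] by auto
  obtain h where h: "h holomorphic_on UNIV" "\<And>z. g z = h z * (z - b) ^ nat (zorder g b)" "h b \<noteq> 0"
    using entire_factor_at[OF g(1) gw] by blast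
  have p: "p analytic_on {b}" "p b \<noteq> 0"
    unfolding p_def using insert by (auto intro!: analytic_intros)
  \<comment> \<open>Additivity of \<open>zorder\<close> requires that the product is not identically
    zero near \<open>b\<close>.\<close>
  have "eventually (\<lambda>z. f z \<noteq> 0) (at b)"
  proof -
    have "h analytic_on {b}" using h(1) analytic_on_holomorphic by blast
    then have "isCont h b" by (rule analytic_at_imp_isCont)
    moreover have "isCont p b" by (rule analytic_at_imp_isCont[OF p(1)])
    ultimately have "eventually (\<lambda>z. h z \<noteq> 0) (at b)" "eventually (\<lambda>z. p z \<noteq> 0) (at b)"
      using h(3) p(2) unfolding isCont_def by (auto intro: tendsto_imp_eventually_ne)
    moreover have "eventually (\<lambda>z. z \<noteq> b) (at b)"
      by (simp add: eventually_at_filter)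
    ultimately show ?thesis
      by eventually_elim (simp add: g(2) h(2))
  qed
  then have "zorder f b = zorder g b + zorder p b"
    using zorder_times_analytic[of g b p] p g
    by (simp add: analytic_on_holomorphic) (metis (no_types, lifting) ext UNIV_I g(2) open_UNIV)
  then have "zorder f b = zorder g b"
    using zorder_eq_0I[OF p] by simp
  then have "f z = h z * (\<Prod>a\<in>insert b F. (z - a) ^ nat (zorder f a))" for z
    using insert(1,2) by (simp add: g(2) h(2)[of z] p_def mult_ac)
  then show ?case using h(1) by blast
qed

text \<open>A weak form of Jensen's inequality. On the circle of radius \<open>3 * r\<close> each
  factor \<open>z - a\<close> has modulus at least \<open>2 * r\<close>, at the origin at most
  \<open>r\<close>. The maximum modulus principle for the quotient \<open>g\<close> therefore gains
  a factor 2 for every zero.\<close>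

lemma zeros_in_disc_bound:
  fixes f :: "complex \<Rightarrow> complex"
  assumes f: "f holomorphic_on UNIV" and f0: "f 0 \<noteq> 0" and r: "r > 0"
    and F: "finite F" "\<And>a. a \<in> F \<Longrightarrow> f a = 0 \<and> norm a \<le> r"
    and M: "\<And>z. norm z = 3 * r \<Longrightarrow> norm (f z) \<le> M"
  shows "2 ^ (\<Sum>a\<in>F. nat (zorder f a)) * norm (f 0) \<le> M"
proof -
  define m where "m a = nat (zorder f a)" for a
  define S where "S = sum m F"
  obtain g where g: "g holomorphic_on UNIV" "\<And>z. f z = g z * (\<Prod>a\<in>F. (z - a) ^ m a)"
    using entire_factor[OF f f0 F(1)] unfolding m_def by blast
  have M0: "M \<ge> 0"
    using order_trans[OF norm_ge_zero M[of "of_real (3 * r)"]] r by (simp add: norm_mult)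
  have "norm (g 0) \<le> M / (2 * r) ^ S"
  proof (rule maximum_modulus_frontier[of g "cball 0 (3 * r)"])
    fix z :: complex assume "z \<in> frontier (cball 0 (3 * r))"
    then have z: "norm z = 3 * r" using r by (simp add: frontier_cball)
    have "(2 * r) ^ S = (\<Prod>a\<in>F. (2 * r) ^ m a)"
      by (simp add: S_def power_sum)
    also have "\<dots> \<le> (\<Prod>a\<in>F. norm (z - a) ^ m a)"
    proof (rule prod_mono, intro conjI power_mono)
      fix a assume "a \<in> F"
      then show "2 * r \<le> norm (z - a)"
        using F(2)[of a] z norm_triangle_ineq2[of z a] by linarith
    qed (use r in auto)
    finally have le: "(2 * r) ^ S \<le> norm (\<Prod>a\<in>F. (z - a) ^ m a)"
      by (simp add: norm_power flip: prod_norm)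
    then have "norm (g z) * (2 * r) ^ S \<le> norm (f z)"
      unfolding g(2) norm_mult by (intro mult_left_mono) auto
    also have "\<dots> \<le> M" by (rule M[OF z])
    finally show "norm (g z) \<le> M / (2 * r) ^ S"
      using r by (simp add: pos_le_divide_eq)
  qed (use r g(1) in \<open>auto intro: holomorphic_on_subset holomorphic_on_imp_continuous_on\<close>)
  moreover have "norm (f 0) \<le> norm (g 0) * r ^ S"
  proof -
    have "(\<Prod>a\<in>F. norm a ^ m a) \<le> (\<Prod>a\<in>F. r ^ m a)"
      by (intro prod_mono conjI power_mono) (use F in auto)
    then show ?thesis
      unfolding g(2) norm_mult
      by (intro mult_left_mono) (simp_all add: S_def power_sum norm_power flip: prod_norm)
  qed
  ultimately have "norm (f 0) \<le> M / (2 * r) ^ S * r ^ S"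
    using r by (meson mult_right_mono order_trans zero_le_power less_imp_le)
  also have "\<dots> = M / 2 ^ S"
    using r by (simp add: power_mult_distrib)
  finally show ?thesis
    by (simp add: S_def m_def field_simps)
qed

text \<open>Dyadic shells: the number of indices with \<open>d i \<le> 2 ^ j\<close> grows like
  \<open>2 powr (j * \<rho>)\<close>, and those in the outermost shell contribute about
  \<open>2 powr (- j * s)\<close> each. A geometric series of ratio \<open>q\<close>
  dominates.\<close>

lemma summable_on_powr_of_counting_bound:
  fixes d :: "'i \<Rightarrow> real"
  assumes \<delta>: "\<delta> > 0" "\<And>i. i \<in> I \<Longrightarrow> d i \<ge> \<delta>" and \<rho>: "\<rho> < s" "s > 0"
    and count: "\<And>G r. finite G \<Longrightarrow> G \<subseteq> I \<Longrightarrow> r \<ge> 1 \<Longrightarrow> real (card {i\<in>G. d i \<le> r}) \<le> C * r powr \<rho>"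
  shows "(\<lambda>i. 1 / d i powr s) summable_on I"
proof (rule nonneg_bdd_above_summable_on)
  define q where "q = 2 powr (\<rho> - s)"
  \<comment> \<open>\<open>2 powr s\<close> pays for the fact that \<open>d i\<close> exceeds only
    half of \<open>2 ^ J i\<close>. The other term covers \<open>J i = 0\<close>, where
    \<open>\<delta>\<close> is the only lower bound.\<close>
  define D where "D = max (2 powr s) (1 / \<delta> powr s)"
  have q: "0 < q" "q < 1" using \<rho> by (auto simp: q_def powr_less_one)
  have C: "C \<ge> 0" using count[of "{}" 1] by simp
  have D: "D \<ge> 0" by (simp add: D_def le_max_iff_disj)
  have "sum (\<lambda>i. 1 / d i powr s) G \<le> D * (C * (1 / (1 - q)))" if G: "finite G" "G \<subseteq> I" for G
  proof -
    define J where "J i = (LEAST j::nat. d i \<le> 2 ^ j)" for i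
    have J: "d i \<le> 2 ^ J i" for i
      unfolding J_def by (rule LeastI_ex) (meson one_less_numeral_iff real_arch_pow less_imp_le semiring_norm(76))
    have term_le: "1 / d i powr s \<le> D * (1 / 2 ^ J i) powr s" if "i \<in> G" for i
    proof (cases "J i")
      case 0
      have "\<delta> powr s \<le> d i powr s"
        using \<delta>(1) \<delta>(2)[of i] that G \<rho> by (intro powr_mono2) auto
      then have "1 / d i powr s \<le> 1 / \<delta> powr s"
        using \<delta>(1) \<delta>(2)[of i] that G by (intro divide_left_mono) auto
      also have "\<dots> \<le> D" by (simp add: D_def)
      finally show ?thesis using 0 by simp
    next
      case (Suc j)
      have "\<not> d i \<le> 2 ^ j"
        using not_less_Least[of j "\<lambda>j. d i \<le> 2 ^ j"] Suc by (simp add: J_def)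
      then have lt: "1 / d i \<le> 2 * (1 / 2 ^ J i)"
        using Suc \<delta>(1) \<delta>(2)[of i] that G by (auto simp: field_simps)
      have dpos: "d i > 0" using \<delta>(1) \<delta>(2)[of i] that G by auto
      have "1 / d i powr s = (1 / d i) powr s"
        using dpos by (simp add: powr_divide)
      also have "\<dots> \<le> (2 * (1 / 2 ^ J i)) powr s"
        using lt dpos \<rho> by (intro powr_mono2) auto
      also have "\<dots> = 2 powr s * (1 / 2 ^ J i) powr s"
        by (subst powr_mult) auto
      also have "\<dots> \<le> D * (1 / 2 ^ J i) powr s"
        by (intro mult_right_mono) (auto simp: D_def)
      finally show ?thesis .
    qed
    define K where "K = Suc (Max (insert 0 (J ` G)))"
    have JK: "J i < K" if "i \<in> G" for i
      using that G(1) by (simp add: K_def less_Suc_eq_le)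
    have "sum (\<lambda>i. 1 / d i powr s) G \<le> (\<Sum>i\<in>G. D * (1 / 2 ^ J i) powr s)"
      by (intro sum_mono term_le)
    \<comment> \<open>Each \<open>i\<close> is charged to every \<open>j < K\<close> with
      \<open>d i \<le> 2 ^ j\<close>, not only to \<open>J i\<close>, so that after swapping the
      sums the counting bound applies directly.\<close>
    also have "\<dots> \<le> (\<Sum>i\<in>G. \<Sum>j<K. if d i \<le> 2 ^ j then D * (1 / 2 ^ j) powr s else 0)"
    proof (rule sum_mono)
      fix i assume "i \<in> G"
      have "D * (1 / 2 ^ J i) powr s = (\<Sum>j\<in>{J i}. if d i \<le> 2 ^ j then D * (1 / 2 ^ j) powr s else 0)"
        using J by simp
      also have "\<dots> \<le> (\<Sum>j<K. if d i \<le> 2 ^ j then D * (1 / 2 ^ j) powr s else 0)"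
        using JK[OF \<open>i \<in> G\<close>] D by (intro sum_mono2) auto
      finally show "D * (1 / 2 ^ J i) powr s \<le> \<dots>" .
    qed
    also have "\<dots> = (\<Sum>j<K. \<Sum>i\<in>G. if d i \<le> 2 ^ j then D * (1 / 2 ^ j) powr s else 0)"
      by (rule sum.swap)
    also have "\<dots> = (\<Sum>j<K. real (card {i\<in>G. d i \<le> 2 ^ j}) * (D * (1 / 2 ^ j) powr s))"
      using G(1) by (simp flip: sum.inter_filter)
    also have "\<dots> \<le> (\<Sum>j<K. C * (2 ^ j) powr \<rho> * (D * (1 / 2 ^ j) powr s))"
      using G D by (intro sum_mono mult_right_mono count) auto
    also have "\<dots> = (\<Sum>j<K. D * C * q ^ j)"
    proof (rule sum.cong[OF refl])
      fix j
      have "(2 ^ j) powr \<rho> * (1 / 2 ^ j) powr s = ((2::real) ^ j) powr (\<rho> - s)"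
        by (simp add: powr_divide powr_diff)
      also have "\<dots> = q ^ j"
        by (simp add: q_def powr_powr mult.commute flip: powr_realpow)
      finally show "C * (2 ^ j) powr \<rho> * (D * (1 / 2 ^ j) powr s) = D * C * q ^ j"
        by (simp add: mult_ac)
    qed
    also have "\<dots> = D * C * (\<Sum>j<K. q ^ j)"
      by (simp add: sum_distrib_left)
    also have "\<dots> \<le> D * C * (1 / (1 - q))"
    proof (intro mult_left_mono)
      show "(\<Sum>j<K. q ^ j) \<le> 1 / (1 - q)"
        using q sum_le_suminf[of "\<lambda>j. q ^ j" "{..<K}"] by (simp add: suminf_geometric summable_geometric)
    qed (use C D in auto)
    finally show ?thesis by (simp add: mult.assoc)
  qed
  then show "bdd_above (sum (\<lambda>i. 1 / d i powr s) ` {F. F \<subseteq> I \<and> finite F})"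
    by (intro bdd_aboveI2) auto
qed auto

text \<open>The growth bound on the circle of radius \<open>3 * r\<close> limits the zeros in the
  disc of radius \<open>r\<close> to a multiple of \<open>r powr \<rho>\<close>. Continuity and
  \<open>f 0 = 1\<close> keep the zeros away from the origin.\<close>

lemma zeros_summable_of_growth:
  fixes f :: "complex \<Rightarrow> complex"
  assumes f: "f holomorphic_on UNIV" and f0: "f 0 = 1" and \<rho>: "\<rho> < s" "s > 0"
    and growth: "\<And>r z. r \<ge> 1 \<Longrightarrow> norm z = r \<Longrightarrow> norm (f z) \<le> exp (C * r powr \<rho>)"
  shows "(\<lambda>(z, k). 1 / norm z powr s) summable_on zeros_with_mult f"
proof -
  have "isCont f 0"
    using f holomorphic_on_imp_continuous_on continuous_on_eq_continuous_at open_UNIV by blast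
  then have "eventually (\<lambda>z. f z \<noteq> 0) (at 0)"
    using f0 unfolding isCont_def by (intro tendsto_imp_eventually_ne[of f "f 0"]) auto
  then obtain \<delta> where \<delta>: "\<delta> > 0" "\<And>z. z \<noteq> 0 \<Longrightarrow> norm z < \<delta> \<Longrightarrow> f z \<noteq> 0"
    unfolding eventually_at by (auto simp: dist_norm)
  have "(\<lambda>i. 1 / norm (fst i) powr s) summable_on zeros_with_mult f"
  proof (rule summable_on_powr_of_counting_bound[OF \<delta>(1) _ \<rho>])
    show "\<delta> \<le> norm (fst i)" if "i \<in> zeros_with_mult f" for i
      using that \<delta>(2)[of "fst i"] f0 by (force simp: zeros_with_mult_def)
    fix G r assume G: "finite G" "G \<subseteq> zeros_with_mult f" and r: "(1::real) \<le> r"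
    let ?H = "{i\<in>G. norm (fst i) \<le> r}"
    let ?N = "\<Sum>a\<in>fst ` ?H. nat (zorder f a)"
    \<comment> \<open>\<open>G\<close> may contain only some copies of a zero, so the orders bound
      its size from above.\<close>
    have "?H \<subseteq> (SIGMA a:fst ` ?H. {..<nat (zorder f a)})"
      using G by (force simp: zeros_with_mult_def)
    then have "card ?H \<le> card (SIGMA a:fst ` ?H. {..<nat (zorder f a)})"
      using G by (intro card_mono finite_SigmaI) auto
    also have "\<dots> = ?N"
      using G by (subst card_SigmaI) auto
    finally have card: "card ?H \<le> ?N" .
    have "2 ^ ?N * norm (f 0) \<le> exp (C * (3 * r) powr \<rho>)"
    proof (rule zeros_in_disc_bound[OF f])
      show "norm (f z) \<le> exp (C * (3 * r) powr \<rho>)" if "norm z = 3 * r" for z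
        using growth[of "3 * r" z] that r by simp
    qed (use G r f0 in \<open>auto simp: zeros_with_mult_def\<close>)
    then have "ln (2 ^ ?N) \<le> C * (3 * r) powr \<rho>"
      using f0 by (subst (asm) ln_le_cancel_iff[symmetric]) auto
    then have "real ?N * ln 2 \<le> C * 3 powr \<rho> * r powr \<rho>"
      using r by (simp add: ln_realpow powr_mult mult_ac)
    then have "real ?N \<le> (C * 3 powr \<rho> / ln 2) * r powr \<rho>"
      by (simp add: pos_le_divide_eq)
    then show "real (card ?H) \<le> (C * 3 powr \<rho> / ln 2) * r powr \<rho>"
      using card by linarith
  qed
  then show ?thesis by (simp add: case_prod_unfold)
qed

section \<open>Growth of an entire function from the decay of its coefficients\<close>

lemma power_series_growth:
  fixes c :: "nat \<Rightarrow> complex"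
  assumes \<rho>: "0 < \<rho>" "\<rho> < \<rho>'"
    and c: "eventually (\<lambda>n. norm (c n) \<le> real n powr (- (real n / \<rho>))) sequentially"
  shows "summable (\<lambda>n. c n * z ^ n)"
    and "\<exists>C. \<forall>r z. r \<ge> 1 \<and> norm z = r \<longrightarrow> norm (\<Sum>n. c n * z ^ n) \<le> exp (C * r powr \<rho>')"
proof -
  obtain n0 where n0: "\<And>n. n \<ge> n0 \<Longrightarrow> norm (c n) \<le> real n powr (- (real n / \<rho>))" "n0 \<ge> 1"
    using c unfolding eventually_sequentially by (metis le_trans nat_le_linear)
  \<comment> \<open>The term is at most the \<open>n\<close>-th power of
    \<open>r / real n powr (1 / \<rho>)\<close>, and this base drops to \<open>1 / 2\<close> once
    \<open>n\<close> reaches \<open>(2 * r) powr \<rho>\<close>.\<close>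
  have small: "norm (c n * z ^ n) \<le> (1 / 2) ^ n"
    if n: "n \<ge> n0" "real n \<ge> (2 * r) powr \<rho>" and r: "r \<ge> 1" "norm z \<le> r" for n r and z :: complex
  proof -
    have npos: "real n > 0" using n n0(2) by auto
    have "2 * r = ((2 * r) powr \<rho>) powr (1 / \<rho>)"
      using r \<rho> by (simp add: powr_powr)
    also have "\<dots> \<le> real n powr (1 / \<rho>)"
      using n \<rho> by (intro powr_mono2) auto
    finally have le: "r / real n powr (1 / \<rho>) \<le> 1 / 2"
      using npos by (simp add: field_simps)
    have "real n powr (- (real n / \<rho>)) = (real n powr (- (1 / \<rho>))) powr real n"
      unfolding powr_powr by simp
    also have "\<dots> = (1 / real n powr (1 / \<rho>)) ^ n"
      using npos by (simp add: powr_minus divide_inverse powr_realpow)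
    finally have decay: "real n powr (- (real n / \<rho>)) = (1 / real n powr (1 / \<rho>)) ^ n" .
    have "norm (c n * z ^ n) \<le> real n powr (- (real n / \<rho>)) * r ^ n"
      unfolding norm_mult norm_power using n0(1)[OF n(1)] r by (intro mult_mono power_mono) auto
    also have "\<dots> = (r / real n powr (1 / \<rho>)) ^ n"
      by (simp add: decay power_divide)
    also have "\<dots> \<le> (1 / 2) ^ n"
      using le r by (intro power_mono) auto
    finally show ?thesis .
  qed
  show "summable (\<lambda>n. c n * z ^ n)" for z
  proof (rule summable_comparison_test'[of "\<lambda>n. (1 / 2) ^ n"])
    define r where "r = max 1 (norm z)"
    fix n assume "n \<ge> max n0 (nat \<lceil>(2 * r) powr \<rho>\<rceil>)"
    then show "norm (c n * z ^ n) \<le> (1 / 2) ^ n"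
      by (intro small[of n r]) (auto simp: r_def)
  qed (simp add: summable_geometric)
  define B where "B = Max (insert 1 ((\<lambda>n. norm (c n)) ` {..<n0}))"
  have B1: "B \<ge> 1" by (simp add: B_def)
  have B: "norm (c n) \<le> B" for n
  proof (cases "n < n0")
    case True
    then show ?thesis by (auto simp: B_def intro!: Max_ge)
  next
    case False
    then have "norm (c n) \<le> real n powr (- (real n / \<rho>))" using n0 by simp
    also have "\<dots> \<le> real n powr 0"
      using False n0(2) \<rho> by (intro powr_mono) auto
    also have "\<dots> \<le> B" using False n0(2) B1 by auto
    finally show ?thesis .
  qed
  define \<epsilon> where "\<epsilon> = \<rho>' - \<rho>"
  define K where "K = real n0 + 1 + 2 powr \<rho>"
  define C where "C = ln B + 2 + K * (1 + 1 / \<epsilon>)"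
  have \<epsilon>: "\<epsilon> > 0" using \<rho> by (simp add: \<epsilon>_def)
  show "\<exists>C. \<forall>r z. r \<ge> 1 \<and> norm z = r \<longrightarrow> norm (\<Sum>n. c n * z ^ n) \<le> exp (C * r powr \<rho>')"
  proof (intro exI[of _ C] allI impI)
    fix r and z :: complex assume "r \<ge> 1 \<and> norm z = r"
    then have r: "r \<ge> 1" "norm z \<le> r" by auto
    \<comment> \<open>From \<open>N\<close> on the terms are geometrically small. The earlier ones
      are at most \<open>B * r ^ N\<close>, and \<open>N\<close> is of size
      \<open>r powr \<rho>\<close>.\<close>
    define N where "N = n0 + nat \<lceil>(2 * r) powr \<rho>\<rceil>"
    have rp: "r powr \<rho> \<ge> 1" "r powr \<rho>' \<ge> 1" "r powr \<epsilon> \<ge> 1"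
      using r \<rho> \<epsilon> by (auto intro!: ge_one_powr_ge_zero)
    have "real N \<le> real n0 + 1 + 2 powr \<rho> * r powr \<rho>"
      using r by (simp add: N_def flip: powr_mult) linarith
    also have "\<dots> \<le> (real n0 + 1) * r powr \<rho> + 2 powr \<rho> * r powr \<rho>"
      using rp mult_left_mono[OF rp(1), of "real n0 + 1"] by auto
    also have "\<dots> = K * r powr \<rho>"
      by (simp add: K_def algebra_simps)
    finally have NK: "real N \<le> K * r powr \<rho>" .
    define f where "f n = norm (c n * z ^ n)" for n
    have summ: "summable (\<lambda>n. (1/2::real) ^ n)" by (simp add: summable_geometric)
    have tail: "f (n + N) \<le> (1 / 2) ^ n" for n
    proof -
      have "f (n + N) \<le> (1 / 2) ^ (n + N)"
        unfolding f_def by (rule small[OF _ _ r]) (auto simp: N_def, linarith)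
      also have "\<dots> \<le> (1 / 2) ^ n" by (intro power_decreasing) auto
      finally show ?thesis .
    qed
    then have sf: "summable (\<lambda>n. f (n + N))"
      by (intro summable_comparison_test'[OF summ, of 0]) (auto simp: f_def)
    then have sf': "summable f" by simp
    have "norm (\<Sum>n. c n * z ^ n) \<le> (\<Sum>n. f n)"
      using sf' unfolding f_def by (rule summable_norm)
    also have "\<dots> = (\<Sum>n. f (n + N)) + (\<Sum>n<N. f n)"
      using sf' by (rule suminf_split_initial_segment)
    also have "(\<Sum>n. f (n + N)) \<le> (\<Sum>n. (1/2) ^ n)"
      by (rule suminf_le[OF tail sf summ])
    also have "\<dots> = 2" by (simp add: suminf_geometric)
    also have "(\<Sum>n<N. f n) \<le> (\<Sum>n<N. B * r ^ N)"
    proof (rule sum_mono)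
      fix n assume n: "n \<in> {..<N}"
      have "f n \<le> B * r ^ n"
        unfolding f_def norm_mult norm_power using B r B1 by (intro mult_mono power_mono) auto
      also have "\<dots> \<le> B * r ^ N"
        using n r B1 by (intro mult_left_mono power_increasing) auto
      finally show "f n \<le> B * r ^ N" .
    qed
    also have "\<dots> = real N * (B * r ^ N)" by simp
    also have "\<dots> \<le> exp (real N) * (B * r ^ N)"
    proof (rule mult_right_mono)
      show "real N \<le> exp (real N)" using exp_ge_add_one_self[of "real N"] by linarith
    qed (use r B1 in auto)
    also have "\<dots> = exp (ln B + real N * (1 + ln r))"
      using r B1 by (simp add: exp_add distrib_left exp_of_nat_mult mult_ac)
    finally have "norm (\<Sum>n. c n * z ^ n) \<le> 2 + exp (ln B + real N * (1 + ln r))" by simp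
    \<comment> \<open>A number \<open>y \<ge> 1\<close> satisfies \<open>2 + y \<le> 3 * y\<close>,
      which absorbs the tail into the exponential.\<close>
    also have "\<dots> \<le> exp 2 * exp (ln B + real N * (1 + ln r))"
    proof -
      have "exp (ln B + real N * (1 + ln r)) \<ge> 1"
        using r B1 by simp
      moreover have "exp (2::real) \<ge> 3" using exp_ge_add_one_self[of 2] by simp
      ultimately have "3 * exp (ln B + real N * (1 + ln r)) \<le> exp 2 * exp (ln B + real N * (1 + ln r))"
        by (intro mult_right_mono) auto
      then show ?thesis
        using \<open>exp (ln B + real N * (1 + ln r)) \<ge> 1\<close> by linarith
    qed
    also have "\<dots> = exp (ln B + 2 + real N * (1 + ln r))"
      by (simp add: exp_add mult_ac)
    also have "\<dots> \<le> exp (C * r powr \<rho>')"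
    proof -
      \<comment> \<open>The logarithm coming from \<open>r ^ N\<close> costs a power
        \<open>\<epsilon>\<close>, hence the passage from \<open>\<rho>\<close> to
        \<open>\<rho>'\<close>.\<close>
      have "1 + ln r \<le> r powr \<epsilon> + r powr \<epsilon> / \<epsilon>"
        using ln_powr_bound[OF r(1) \<epsilon>] rp by linarith
      then have "real N * (1 + ln r) \<le> (K * r powr \<rho>) * (r powr \<epsilon> + r powr \<epsilon> / \<epsilon>)"
        using NK r by (intro mult_mono) auto
      also have "\<dots> = K * (1 + 1 / \<epsilon>) * r powr \<rho>'"
      proof -
        have "r powr \<rho> * r powr \<epsilon> = r powr \<rho>'"
          using r by (simp add: \<epsilon>_def flip: powr_add)
        then have "K * (1 + 1 / \<epsilon>) * r powr \<rho>' = K * (1 + 1 / \<epsilon>) * (r powr \<rho> * r powr \<epsilon>)" by simp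
        then show ?thesis by (simp add: algebra_simps)
      qed
      finally have "real N * (1 + ln r) \<le> K * (1 + 1 / \<epsilon>) * r powr \<rho>'" .
      moreover have "ln B + 2 \<le> (ln B + 2) * r powr \<rho>'"
        using mult_left_mono[OF rp(2), of "ln B + 2"] B1 by simp
      ultimately show ?thesis by (simp add: C_def algebra_simps)
    qed
    finally show "norm (\<Sum>n. c n * z ^ n) \<le> exp (C * r powr \<rho>')" .
  qed
qed

subsection \<open>Cholesky decomposition of a trace-class operator\<close>

lemma norm_scaleC: "norm (a *\<^sub>C x) = norm a * norm x" for x :: "'a::complex_hilbert"
proof (rule power2_eq_imp_eq)
  have "complex_of_real ((norm (a *\<^sub>C x))\<^sup>2) = a * cnj a * cinner x x"
    by (subst cinner_self[symmetric]) (simp add: cinner_scaleC_left cinner_scaleC_right)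
  also have "\<dots> = of_real ((norm a * norm x)\<^sup>2)"
    unfolding power_mult_distrib of_real_mult complex_norm_square[of a] cinner_self ..
  finally show "(norm (a *\<^sub>C x))\<^sup>2 = (norm a * norm x)\<^sup>2"
    using of_real_eq_iff by blast
qed auto

lemma scaleC_zero_left: "(0::complex) *\<^sub>C x = 0" for x :: "'a::complex_hilbert"
  using norm_scaleC[of 0 x] by simp

lemma bounded_clinear_diff_rank_one:
  assumes "bounded_clinear A"
  shows "bounded_clinear (\<lambda>x. A x - cinner w x *\<^sub>C u)"
proof -
  have A: "bounded_linear A" "\<And>a x. A (a *\<^sub>C x) = a *\<^sub>C A x"
    using assms by (auto simp: bounded_clinear_def)
  have "bounded_linear (\<lambda>x. cinner w x *\<^sub>C u)"
  proof (rule bounded_linear_intro[where K = "norm w * norm u"])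
    fix x
    have "norm (cinner w x *\<^sub>C u) = norm (cinner w x) * norm u"
      by (rule norm_scaleC)
    also have "\<dots> \<le> (norm w * norm x) * norm u"
      by (intro mult_right_mono cinner_Cauchy_Schwarz) auto
    finally show "norm (cinner w x *\<^sub>C u) \<le> norm x * (norm w * norm u)"
      by (simp add: mult_ac)
  qed (simp_all add: cinner_add_right scaleC_add_left cinner_scaleC_right scaleR_eq_scaleC scaleC_scaleC)
  then have "bounded_linear (\<lambda>x. A x - cinner w x *\<^sub>C u)"
    using A by (intro bounded_linear_sub)
  moreover have "A (a *\<^sub>C x) - cinner w (a *\<^sub>C x) *\<^sub>C u = a *\<^sub>C (A x - cinner w x *\<^sub>C u)" for a x
    using scaleC_add_right[of a "A x - cinner w x *\<^sub>C u" "cinner w x *\<^sub>C u"]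
    by (simp add: A cinner_scaleC_right scaleC_scaleC)
  ultimately show ?thesis by (simp add: bounded_clinear_def)
qed

section \<open>Positive operators and their Cauchy-Schwarz inequality\<close>

definition positive_op :: "('a::complex_hilbert \<Rightarrow> 'a) \<Rightarrow> bool" where
  "positive_op P \<longleftrightarrow> bounded_clinear P \<and> (\<forall>x. Im (cinner x (P x)) = 0 \<and> 0 \<le> Re (cinner x (P x)))"

context
  fixes P :: "'a::complex_hilbert \<Rightarrow> 'a"
  assumes P: "positive_op P"
begin

lemma positive_op_add: "P (x + y) = P x + P y"
  and positive_op_diff: "P (x - y) = P x - P y"
  and positive_op_scaleC: "P (a *\<^sub>C x) = a *\<^sub>C P x"
proof -
  have bl: "bounded_linear P" and "\<And>a x. P (a *\<^sub>C x) = a *\<^sub>C P x"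
    using P by (auto simp: positive_op_def bounded_clinear_def)
  then show "P (a *\<^sub>C x) = a *\<^sub>C P x" by simp
  show "P (x + y) = P x + P y" "P (x - y) = P x - P y"
    using linear_add linear_diff bounded_linear.linear[OF bl] by blast+
qed

lemma positive_op_diag: "cinner x (P x) = of_real (Re (cinner x (P x)))" "0 \<le> Re (cinner x (P x))"
  using P by (auto simp: positive_op_def complex_eq_iff)

text \<open>Polarisation: realness of the form at \<open>x + y\<close> settles the imaginary parts,
  realness at \<open>x + \<i> *\<^sub>C y\<close> the real parts.\<close>

lemma positive_op_hermitian: "cinner x (P y) = cnj (cinner y (P x))"
proof -
  have i: "Im (cinner z (P z)) = 0" for z
    using P by (simp add: positive_op_def)
  have "Im (cinner x (P y) + cinner y (P x)) = 0"
    using i[of "x + y"] i[of x] i[of y]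
    by (simp add: positive_op_add cinner_add_left cinner_add_right)
  moreover have "Re (cinner x (P y)) - Re (cinner y (P x)) = 0"
    using i[of "x + \<i> *\<^sub>C y"] i[of x] i[of y]
    by (simp add: positive_op_add positive_op_scaleC cinner_add_left cinner_add_right
        cinner_scaleC_left cinner_scaleC_right)
  ultimately show ?thesis by (simp add: complex_eq_iff)
qed

lemma positive_op_adjoint: "cinner (P x) y = cinner x (P y)"
  by (metis positive_op_hermitian cinner_commute)

text \<open>A discriminant argument. The form is nonnegative along
  \<open>x - (of_real t * cnj c) *\<^sub>C y\<close>, where the factor \<open>cnj c\<close> makes
  the cross terms real.\<close>

lemma positive_op_Cauchy_Schwarz:
  "(norm (cinner x (P y)))\<^sup>2 \<le> Re (cinner x (P x)) * Re (cinner y (P y))"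
proof -
  define a b c where "a = Re (cinner x (P x))" and "b = Re (cinner y (P y))" and "c = cinner x (P y)"
  have quad: "0 \<le> a - 2 * t * (norm c)\<^sup>2 + t\<^sup>2 * (norm c)\<^sup>2 * b" for t :: real
  proof -
    define z where "z = x - (of_real t * cnj c) *\<^sub>C y"
    have yx: "cinner y (P x) = cnj c" unfolding c_def by (rule positive_op_hermitian)
    have xx: "cinner x (P x) = of_real a" and yy: "cinner y (P y) = of_real b"
      unfolding a_def b_def by (rule positive_op_diag(1))+
    have "cinner z (P z) = of_real a - of_real t * (cnj c * c) - of_real t * (c * cnj c)
        + of_real t * of_real t * (c * cnj c) * of_real b"
      unfolding z_def positive_op_diff positive_op_scaleC cinner_diff_left cinner_diff_right
        cinner_scaleC_left cinner_scaleC_right yx c_def[symmetric]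
        xx yy
      by (simp add: algebra_simps)
    also have "\<dots> = of_real (a - 2 * t * (norm c)\<^sup>2 + t\<^sup>2 * (norm c)\<^sup>2 * b)"
      unfolding of_real_add of_real_diff of_real_mult complex_norm_square
      by (simp add: power2_eq_square algebra_simps)
    finally have "Re (cinner z (P z)) = a - 2 * t * (norm c)\<^sup>2 + t\<^sup>2 * (norm c)\<^sup>2 * b"
      by simp
    then show ?thesis using positive_op_diag(2)[of z] by simp
  qed
  have ab: "a \<ge> 0" "b \<ge> 0" using positive_op_diag(2) by (auto simp: a_def b_def)
  have "(norm c)\<^sup>2 \<le> a * b"
  proof (cases "b = 0")
    case True
    show ?thesis
    proof (rule ccontr)
      assume "\<not> ?thesis"
      then have "(norm c)\<^sup>2 > 0" using True by simp
      \<comment> \<open>For \<open>b = 0\<close> the quadratic degenerates to a linear function of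
        \<open>t\<close>, which takes the value -1 at this point.\<close>
      then show False using quad[of "(a + 1) / (2 * (norm c)\<^sup>2)"] True by (simp add: field_simps)
    qed
  next
    case False
    then have "b > 0" using ab by simp
    \<comment> \<open>\<open>t = 1 / b\<close> minimises the quadratic if \<open>c\<close> is
      nonzero.\<close>
    then show ?thesis using quad[of "1 / b"] by (simp add: field_simps power2_eq_square)
  qed
  then show ?thesis by (simp add: a_def b_def c_def)
qed

end

text \<open>One step of the Cholesky decomposition of \<open>|A|\<close>, carried along for \<open>A\<close> itself.\<close>

lemma cholesky_step:
  fixes A P :: "'a::complex_hilbert \<Rightarrow> 'a"
  assumes P: "positive_op P" and A: "bounded_clinear A" and eq: "\<And>x. norm (A x) = norm (P x)"
  obtains w u where
    "norm u = norm w"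
    "positive_op (\<lambda>x. P x - cinner w x *\<^sub>C w)"
    "\<And>x. norm (A x - cinner w x *\<^sub>C u) = norm (P x - cinner w x *\<^sub>C w)"
    "P e - cinner w e *\<^sub>C w = 0"
    "\<And>x. P x = 0 \<Longrightarrow> cinner w x = 0"
proof -
  define d where "d = Re (cinner e (P e))"
  \<comment> \<open>Division by zero gives 0: for \<open>d = 0\<close> the vectors \<open>w\<close>
    and \<open>u\<close> vanish and the step changes nothing. This is right because
    \<open>P e = 0\<close> in that case.\<close>
  define q :: complex where "q = of_real (1 / sqrt d)"
  define w u where "w = q *\<^sub>C P e" and "u = q *\<^sub>C A e"
  have d0: "d \<ge> 0" using positive_op_diag(2)[OF P] by (simp add: d_def)
  have dee: "cinner e (P e) = of_real d" using positive_op_diag(1)[OF P] by (simp add: d_def)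
  have qq: "q * q = of_real (1 / d)" "cnj q = q"
    using d0 by (auto simp: q_def simp flip: of_real_mult)
  have Pe0: "P e = 0" if "d = 0"
  proof -
    have "(norm (cinner (P e) (P e)))\<^sup>2 \<le> 0"
      using positive_op_Cauchy_Schwarz[OF P, of "P e" e] that by (simp add: d_def)
    then show ?thesis by (simp add: cinner_self)
  qed
  have w: "cinner w x = q * cinner e (P x)" for x
    by (simp add: w_def cinner_scaleC_left qq positive_op_adjoint[OF P])
  define c where "c x = q * q * cinner e (P x)" for x
  \<comment> \<open>Subtracting the rank-one term shifts the argument by a multiple of
    \<open>e\<close>, the same multiple for \<open>P\<close> and for \<open>A\<close>. The equality
    of norms is therefore inherited.\<close>
  have Pw: "P x - cinner w x *\<^sub>C w = P (x - c x *\<^sub>C e)" for x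
    by (simp add: positive_op_diff[OF P] positive_op_scaleC[OF P] c_def w scaleC_scaleC mult_ac)
      (simp add: w_def scaleC_scaleC mult_ac)
  have Au: "A x - cinner w x *\<^sub>C u = A (x - c x *\<^sub>C e)" for x
    using A linear_diff[of A] bounded_linear.linear[of A]
    by (simp add: bounded_clinear_def c_def w scaleC_scaleC mult_ac)
      (simp add: u_def scaleC_scaleC mult_ac)
  show thesis
  proof (rule that)
    show "norm u = norm w" by (simp add: u_def w_def norm_scaleC eq)
    show "norm (A x - cinner w x *\<^sub>C u) = norm (P x - cinner w x *\<^sub>C w)" for x
      unfolding Pw Au by (rule eq)
    show "P e - cinner w e *\<^sub>C w = 0"
    proof (cases "d = 0")
      case True
      then show ?thesis by (simp add: w Pe0 scaleC_zero_left)
    next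
      case False
      then have "c e = 1" by (simp add: c_def qq dee)
      moreover have "(1::complex) *\<^sub>C e = e" using scaleR_eq_scaleC[of 1 e] by simp
      moreover have "P 0 = 0" using positive_op_diff[OF P, of 0 0] by simp
      ultimately show ?thesis unfolding Pw by simp
    qed
    show "cinner w x = 0" if "P x = 0" for x by (simp add: w that)
    show "positive_op (\<lambda>x. P x - cinner w x *\<^sub>C w)"
      unfolding positive_op_def
    proof (intro conjI allI)
      show "bounded_clinear (\<lambda>x. P x - cinner w x *\<^sub>C w)"
        using P by (intro bounded_clinear_diff_rank_one) (simp add: positive_op_def)
      fix x
      have "cinner w x * cinner x w = of_real ((norm (cinner w x))\<^sup>2)"
        by (subst cinner_commute[of x w]) (simp only: complex_norm_square)
      then have *: "cinner x (P x - cinner w x *\<^sub>C w) =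
          of_real (Re (cinner x (P x)) - (norm (cinner w x))\<^sup>2)"
        by (simp add: cinner_diff_right cinner_scaleC_right flip: positive_op_diag(1)[OF P])
      \<comment> \<open>Positivity of the remainder is exactly Cauchy-Schwarz for the form of
        \<open>P\<close> at \<open>e\<close> and \<open>x\<close>.\<close>
      have "(norm (cinner w x))\<^sup>2 = (norm (cinner e (P x)))\<^sup>2 / d"
        using d0 by (simp add: w norm_mult q_def power_mult_distrib power_divide norm_divide)
      also have "\<dots> \<le> Re (cinner x (P x))"
        using positive_op_Cauchy_Schwarz[OF P, of e x] d0 positive_op_diag(2)[OF P, of x]
        by (cases "d = 0") (simp_all add: d_def field_simps)
      finally show "Im (cinner x (P x - cinner w x *\<^sub>C w)) = 0"
        "0 \<le> Re (cinner x (P x - cinner w x *\<^sub>C w))"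
        unfolding * by simp_all
    qed
  qed
qed

text \<open>Step \<open>N\<close> treats \<open>e N\<close>. Vectors annihilated earlier stay
  annihilated, since each new \<open>w\<close> is orthogonal to the kernel of the current
  remainder.\<close>

lemma cholesky_sequence:
  fixes A P :: "'a::complex_hilbert \<Rightarrow> 'a" and e :: "nat \<Rightarrow> 'a"
  assumes P: "positive_op P" and A: "bounded_clinear A" and eq: "\<And>x. norm (A x) = norm (P x)"
  obtains w u :: "nat \<Rightarrow> 'a" where
    "\<And>k. norm (u k) = norm (w k)"
    "\<And>N. positive_op (\<lambda>x. P x - (\<Sum>k<N. cinner (w k) x *\<^sub>C w k))"
    "\<And>N. bounded_clinear (\<lambda>x. A x - (\<Sum>k<N. cinner (w k) x *\<^sub>C u k))"
    "\<And>N x. norm (A x - (\<Sum>k<N. cinner (w k) x *\<^sub>C u k)) = norm (P x - (\<Sum>k<N. cinner (w k) x *\<^sub>C w k))"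
    "\<And>N j. j < N \<Longrightarrow> P (e j) - (\<Sum>k<N. cinner (w k) (e j) *\<^sub>C w k) = 0"
proof -
  \<comment> \<open>The clause for \<open>n = 0\<close> forces the chosen sequence to start at
    \<open>(P, A)\<close>; dependent choice by itself only yields some good initial state.\<close>
  define good where "good n S \<longleftrightarrow> positive_op (fst S) \<and> bounded_clinear (snd S) \<and>
      (\<forall>x. norm (snd S x) = norm (fst S x)) \<and> (n = 0 \<longrightarrow> S = (P, A)) \<and> (\<forall>j<n. fst S (e j) = 0)"
    for n :: nat and S :: "('a \<Rightarrow> 'a) \<times> ('a \<Rightarrow> 'a)"
  define step where "step S S' w u \<longleftrightarrow> norm u = norm w \<and>
      S' = ((\<lambda>x. fst S x - cinner w x *\<^sub>C w), (\<lambda>x. snd S x - cinner w x *\<^sub>C u))"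
    for S S' :: "('a \<Rightarrow> 'a) \<times> ('a \<Rightarrow> 'a)" and w u :: 'a
  have "\<exists>S. \<forall>n. good n (S n) \<and> (\<exists>w u. step (S n) (S (Suc n)) w u)"
  proof (rule dependent_nat_choice)
    show "\<exists>S. good 0 S" using P A eq by (auto simp: good_def)
    fix S n assume g: "good n S"
    have S: "positive_op (fst S)" "bounded_clinear (snd S)" "\<And>x. norm (snd S x) = norm (fst S x)"
      using g by (auto simp: good_def)
    obtain w u where wu: "norm u = norm w" "positive_op (\<lambda>x. fst S x - cinner w x *\<^sub>C w)"
      "\<And>x. norm (snd S x - cinner w x *\<^sub>C u) = norm (fst S x - cinner w x *\<^sub>C w)"
      "fst S (e n) - cinner w (e n) *\<^sub>C w = 0" "\<And>x. fst S x = 0 \<Longrightarrow> cinner w x = 0"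
      by (rule cholesky_step[OF S, of "e n"]) (rule that)
    have "good (Suc n) ((\<lambda>x. fst S x - cinner w x *\<^sub>C w), (\<lambda>x. snd S x - cinner w x *\<^sub>C u))"
      using g wu bounded_clinear_diff_rank_one[of "snd S" w u] by (auto simp: good_def less_Suc_eq scaleC_zero_left)
    then show "\<exists>S'. good (Suc n) S' \<and> (\<exists>w u. step S S' w u)"
      unfolding step_def using wu(1) by blast
  qed
  then obtain S where S: "\<And>n. good n (S n)" "\<And>n. \<exists>w u. step (S n) (S (Suc n)) w u" by blast
  then obtain w u where wu: "\<And>n. step (S n) (S (Suc n)) (w n) (u n)" by metis
  have S_eq: "fst (S N) x = P x - (\<Sum>k<N. cinner (w k) x *\<^sub>C w k)"
    "snd (S N) x = A x - (\<Sum>k<N. cinner (w k) x *\<^sub>C u k)" for N x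
  proof (induction N)
    case 0
    { case 1 then show ?case using S(1)[of 0] by (simp add: good_def) }
    { case 2 then show ?case using S(1)[of 0] by (simp add: good_def) }
  next
    case (Suc N)
    { case 1 then show ?case using wu[of N] Suc by (simp add: step_def) }
    { case 2 then show ?case using wu[of N] Suc by (simp add: step_def) }
  qed
  have fS: "fst (S N) = (\<lambda>x. P x - (\<Sum>k<N. cinner (w k) x *\<^sub>C w k))"
     "snd (S N) = (\<lambda>x. A x - (\<Sum>k<N. cinner (w k) x *\<^sub>C u k))" for N
    by (auto simp: S_eq)
  show thesis
  proof (rule that[of u w])
    show "norm (u k) = norm (w k)" for k using wu[of k] by (simp add: step_def)
  qed (use S(1) in \<open>unfold good_def fS, blast+\<close>)
qed

section \<open>Nuclear expansion of a trace-class operator\<close>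

lemma Parseval_norm:
  fixes x :: "'a::complex_hilbert"
  assumes "orthonormal_basis UNIV cinner B"
  shows "((\<lambda>e. (norm (cinner e x))\<^sup>2) has_sum (norm x)\<^sup>2) B"
proof -
  have "Re (cinner x e * cinner e x) = (norm (cinner e x))\<^sup>2" for e
  proof -
    have "cinner x e * cinner e x = of_real ((norm (cinner e x))\<^sup>2)"
      by (subst cinner_commute[of x e]) (simp only: complex_norm_square mult.commute)
    then show ?thesis by simp
  qed
  moreover have "Re (cinner x x) = (norm x)\<^sup>2"
    by (simp add: cinner_self del: of_real_power)
  ultimately show ?thesis
    using has_sum_Re[OF Parseval[OF assms, of x x]] by simp
qed

text \<open>Parseval for \<open>P x\<close>, with Cauchy-Schwarz for the form of \<open>P\<close> in
  every term, bounds the squared norm by \<open>\<tau> * Re (cinner x (P x))\<close>; one factor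
  \<open>norm (P x)\<close> then cancels.\<close>

lemma norm_le_trace_mult:
  fixes P :: "'a::complex_hilbert \<Rightarrow> 'a"
  assumes P: "positive_op P" and B: "orthonormal_basis UNIV cinner B"
    and tr: "((\<lambda>e. Re (cinner e (P e))) has_sum \<tau>) B"
  shows "norm (P x) \<le> \<tau> * norm x"
proof (cases "P x = 0")
  case True
  have "\<tau> \<ge> 0" using has_sum_nonneg[OF tr] positive_op_diag(2)[OF P] by simp
  then show ?thesis using True by simp
next
  case False
  have "((\<lambda>e. (norm (cinner e (P x)))\<^sup>2) has_sum (norm (P x))\<^sup>2) B"
    by (rule Parseval_norm[OF B])
  moreover have "((\<lambda>e. Re (cinner e (P e)) * Re (cinner x (P x))) has_sum \<tau> * Re (cinner x (P x))) B"
    by (rule has_sum_cmult_left[OF tr])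
  ultimately have "(norm (P x))\<^sup>2 \<le> \<tau> * Re (cinner x (P x))"
    by (rule has_sum_mono) (rule positive_op_Cauchy_Schwarz[OF P])
  also have "\<dots> \<le> \<tau> * (norm x * norm (P x))"
    using has_sum_nonneg[OF tr] positive_op_diag(2)[OF P]
    by (intro mult_left_mono order_trans[OF complex_Re_le_cmod cinner_Cauchy_Schwarz]) auto
  finally show ?thesis
    using False by (simp add: power2_eq_square mult_ac)
qed

text \<open>Distinct orthonormal vectors are \<open>sqrt 2\<close> apart, so nearby points of a
  countable dense set are distinct too.\<close>

lemma countable_orthonormal:
  fixes B :: "'a::complex_hilbert set"
  assumes sep: "separable_space (euclidean :: 'a topology)" and B: "orthonormal UNIV cinner B"
  shows "countable B"
proof -
  obtain C :: "'a set" where C: "countable C" "closure C = UNIV"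
    using sep by (auto simp: separable_space_def)
  have "\<exists>c\<in>C. dist c b < 1 / 2" for b
    using C(2) closure_approachable[of b C] by (metis UNIV_I half_gt_zero_iff zero_less_one)
  then obtain c where c: "\<And>b. c b \<in> C" "\<And>b. dist (c b) b < 1 / 2" by metis
  have "inj_on c B"
  proof (rule inj_onI, rule ccontr)
    fix a b assume ab: "a \<in> B" "b \<in> B" "c a = c b" "a \<noteq> b"
    have "dist a b < 1"
      using c(2)[of a] c(2)[of b] ab(3) by (metis dist_commute dist_triangle_half_r)
    moreover have "complex_of_real ((norm (a - b))\<^sup>2) = 2"
      using B ab by (subst cinner_self[symmetric])
        (simp add: cinner_diff_left cinner_diff_right orthonormal_def)
    then have "(norm (a - b))\<^sup>2 = 2"
      by (metis of_real_eq_iff of_real_numeral)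
    ultimately show False
      using power_mono[of "norm (a - b)" 1 2] by (simp add: dist_norm)
  qed
  then show ?thesis
    using C(1) c(1) by (meson countable_subset countable_image_inj_on image_subsetI)
qed

text \<open>The norm of the remainder of \<open>A\<close> is at most the trace
  \<open>\<tau> N\<close> of the remainder of \<open>|A|\<close>. The diagonal of the latter is
  dominated by that of \<open>|A|\<close> and vanishes on the basis vectors already treated.\<close>

lemma nuclear_decomposition:
  fixes A :: "'a::complex_hilbert \<Rightarrow> 'a"
  assumes sep: "separable_space (euclidean :: 'a topology)" and A: "trace_class A"
  obtains w u :: "nat \<Rightarrow> 'a" where
    "\<And>k. norm (u k) = norm (w k)" "summable (\<lambda>k. (norm (w k))\<^sup>2)"
    "\<And>N. bounded_clinear (\<lambda>x. A x - (\<Sum>k<N. cinner (w k) x *\<^sub>C u k))"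
    "(\<lambda>N. onorm (\<lambda>x. A x - (\<Sum>k<N. cinner (w k) x *\<^sub>C u k))) \<longlonglongrightarrow> 0"
proof -
  define B where "B = some_basis UNIV (cinner :: 'a \<Rightarrow> _)"
  have B: "orthonormal_basis UNIV cinner B" unfolding B_def by (rule orthonormal_basis_some)
  obtain P where abs: "is_abs_op A P" and sumP: "(\<lambda>e. cinner e (P e)) summable_on B"
    using A by (auto simp: trace_class_def B_def)
  have P: "positive_op P" using abs by (simp add: is_abs_op_def positive_op_def)
  have bA: "bounded_clinear A" using A by (simp add: trace_class_def)
  have eq: "norm (A x) = norm (P x)" for x
  proof (rule power2_eq_imp_eq)
    have "cinner (A x) (A x) = cinner (P x) (P x)"
      using abs by (simp add: is_abs_op_def positive_op_adjoint[OF P])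
    then show "(norm (A x))\<^sup>2 = (norm (P x))\<^sup>2"
      unfolding cinner_self using of_real_eq_iff by blast
  qed auto
  have cB: "countable B"
    using countable_orthonormal[OF sep] B by (simp add: orthonormal_basis_def)
  obtain w u where
    norm_u: "\<And>k. norm (u k) = norm (w k)" and
    PN: "\<And>N. positive_op (\<lambda>x. P x - (\<Sum>k<N. cinner (w k) x *\<^sub>C w k))" and
    AN: "\<And>N. bounded_clinear (\<lambda>x. A x - (\<Sum>k<N. cinner (w k) x *\<^sub>C u k))" and
    eqN: "\<And>N x. norm (A x - (\<Sum>k<N. cinner (w k) x *\<^sub>C u k)) = norm (P x - (\<Sum>k<N. cinner (w k) x *\<^sub>C w k))" and
    zero: "\<And>N j. j < N \<Longrightarrow> P (from_nat_into B j) - (\<Sum>k<N. cinner (w k) (from_nat_into B j) *\<^sub>C w k) = 0"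
    \<comment> \<open>If \<open>B\<close> is finite the enumeration runs out of fresh vectors. This
      is harmless: what counts is that every element of \<open>B\<close> is reached.\<close>
    by (rule cholesky_sequence[OF P bA eq, where e = "from_nat_into B"]) (rule that)
  define p where "p e = Re (cinner e (P e))" for e
  define pN where "pN N e = Re (cinner e (P e - (\<Sum>k<N. cinner (w k) e *\<^sub>C w k)))" for N e
  have p: "p summable_on B" unfolding p_def using sumP by (rule summable_on_Re)
  have pN_eq: "pN N e = p e - (\<Sum>k<N. (norm (cinner e (w k)))\<^sup>2)" for N e
  proof -
    have "cinner (w k) e * cinner e (w k) = of_real ((norm (cinner e (w k)))\<^sup>2)" for k
      by (subst cinner_commute[of "w k" e]) (simp only: complex_norm_square mult.commute)
    then show ?thesis
      by (simp add: pN_def p_def cinner_diff_right cinner_sum_right cinner_scaleC_right del: of_real_power)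
  qed
  have pN0: "pN N e \<ge> 0" for N e
    unfolding pN_def using positive_op_diag(2)[OF PN] by blast
  have pN_le: "pN N e \<le> p e" for N e
    unfolding pN_eq by (simp add: sum_nonneg)
  have pN: "pN N summable_on B" for N
    using p by (rule summable_on_comparison_test) (use pN0 pN_le in auto)
  define \<tau> where "\<tau> N = infsum (pN N) B" for N
  have "norm (A x - (\<Sum>k<N. cinner (w k) x *\<^sub>C u k)) \<le> \<tau> N * norm x" for N x
    unfolding eqN using norm_le_trace_mult[OF PN B, of N "\<tau> N"] pN[of N]
    by (simp add: \<tau>_def pN_def[symmetric] has_sum_infsum)
  then have onorm_AN: "onorm (\<lambda>x. A x - (\<Sum>k<N. cinner (w k) x *\<^sub>C u k)) \<le> \<tau> N" for N
    using pN0 infsum_nonneg[of B "pN N"] by (intro onorm_bound) (auto simp: \<tau>_def)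
  have \<tau>: "\<tau> \<longlonglongrightarrow> 0"
  proof (rule tendstoI)
    fix \<epsilon> :: real assume "\<epsilon> > 0"
    then have "\<forall>\<^sub>F F in finite_subsets_at_top B. dist (sum p F) (infsum p B) < \<epsilon>"
      using has_sum_infsum[OF p] unfolding has_sum_def by (rule tendstoD[rotated])
    then obtain F where F: "finite F" "F \<subseteq> B" "dist (sum p F) (infsum p B) < \<epsilon>"
      unfolding eventually_finite_subsets_at_top by auto
    \<comment> \<open>Past this index all of \<open>F\<close> has been treated, so
      \<open>\<tau> N\<close> is bounded by the part of the trace of \<open>|A|\<close> outside
      \<open>F\<close>.\<close>
    have "\<bar>\<tau> N\<bar> < \<epsilon>" if N: "N \<ge> Suc (Max (insert 0 (to_nat_on B ` F)))" for N
    proof -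
      have "pN N b = 0" if "b \<in> F" for b
      proof -
        have "to_nat_on B b < N"
          using F that N by (meson Max_ge finite_imageI finite_insert imageI insertI2 le_imp_less_Suc le_trans less_le_trans)
        moreover have "from_nat_into B (to_nat_on B b) = b"
          using F that cB by (intro from_nat_into_to_nat_on) auto
        ultimately show ?thesis using zero[of "to_nat_on B b" N] by (simp add: pN_def)
      qed
      then have "\<tau> N = infsum (pN N) (B - F)"
        unfolding \<tau>_def by (intro infsum_cong_neutral) auto
      also have "\<dots> \<le> infsum p (B - F)"
        using pN p pN_le by (intro infsum_mono summable_on_subset_banach[where B = "B - F"]) auto
      also have "\<dots> = infsum p B - sum p F"
        using F p by (subst infsum_Diff) auto
      also have "\<dots> < \<epsilon>" using F(3) by (simp add: dist_real_def)
      finally show ?thesis using infsum_nonneg[of B "pN N"] pN0 by (simp add: \<tau>_def)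
    qed
    then show "\<forall>\<^sub>F N in sequentially. dist (\<tau> N) 0 < \<epsilon>"
      unfolding eventually_sequentially by (auto simp: dist_real_def)
  qed
  have "(\<lambda>N. onorm (\<lambda>x. A x - (\<Sum>k<N. cinner (w k) x *\<^sub>C u k))) \<longlonglongrightarrow> 0"
    by (rule tendsto_sandwich[OF _ _ tendsto_const \<tau>])
      (use AN onorm_AN in \<open>auto simp: bounded_clinear_def onorm_pos_le\<close>)
  moreover have "summable (\<lambda>k. (norm (w k))\<^sup>2)"
  proof (rule summableI_nonneg_bounded)
    fix N
    \<comment> \<open>Parseval spreads the squared norms over the basis, and positivity of the
      remainder caps their sum at \<open>p e\<close> for each \<open>e\<close>.\<close>
    have "((\<lambda>e. \<Sum>k<N. (norm (cinner e (w k)))\<^sup>2) has_sum (\<Sum>k<N. (norm (w k))\<^sup>2)) B"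
      by (induction N) (auto intro: has_sum_add Parseval_norm[OF B])
    moreover have "(\<Sum>k<N. (norm (cinner e (w k)))\<^sup>2) \<le> p e" for e
      using pN0[of N e] pN_eq[of N e] by linarith
    ultimately show "(\<Sum>k<N. (norm (w k))\<^sup>2) \<le> infsum p B"
      by (intro has_sum_mono[OF _ has_sum_infsum[OF p]])
  qed auto
  ultimately show thesis using norm_u AN by (intro that[of u w])
qed

subsection \<open>Multilinear forms in the exterior power\<close>

lemma bounded_clinear_lincomb:
  fixes f g :: "'a::complex_hilbert \<Rightarrow> complex"
  assumes "bounded_clinear f" "bounded_clinear g"
  shows "bounded_clinear (\<lambda>x. a * f x + b * g x)"
  using assms unfolding bounded_clinear_def
  by (auto intro!: bounded_linear_add bounded_linear_const_mult simp: scaleC_complex_def algebra_simps)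

lemma bounded_clinear_sum:
  fixes \<psi> :: "'k \<Rightarrow> 'a::complex_hilbert \<Rightarrow> complex"
  assumes "finite K" "\<And>k. k \<in> K \<Longrightarrow> bounded_clinear (\<psi> k)"
  shows "bounded_clinear (\<lambda>x. \<Sum>k\<in>K. c k * \<psi> k x)"
  using assms
proof (induction K)
  case empty
  show ?case by (simp add: bounded_clinear_def scaleC_complex_def)
next
  case (insert k K)
  then show ?case
    using bounded_clinear_lincomb[of "\<psi> k" "\<lambda>x. \<Sum>k\<in>K. c k * \<psi> k x" "c k" 1] by simp
qed

lemma dual_tuples_restrict:
  "(\<And>i. i < n \<Longrightarrow> bounded_clinear (\<psi> i)) \<Longrightarrow> (\<lambda>i\<in>{..<n}. \<psi> i) \<in> dual_tuples n"
  by (auto simp: dual_tuples_def)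

lemma dual_tuples_upd:
  "\<phi> \<in> dual_tuples n \<Longrightarrow> i < n \<Longrightarrow> bounded_clinear f \<Longrightarrow> \<phi>(i := f) \<in> dual_tuples n"
  by (auto simp: dual_tuples_def PiE_iff extensional_def)

context
  fixes n :: nat and \<omega> :: "(nat \<Rightarrow> 'a::complex_hilbert \<Rightarrow> complex) \<Rightarrow> complex"
  assumes \<omega>: "\<omega> \<in> ext_space n"
begin

lemma ext_space_lincomb:
  assumes "\<phi> \<in> dual_tuples n" "i < n" "bounded_clinear f" "bounded_clinear g"
  shows "\<omega> (\<phi>(i := (\<lambda>x. a * f x + b * g x))) = a * \<omega> (\<phi>(i := f)) + b * \<omega> (\<phi>(i := g))"
  using \<omega> assms unfolding ext_space_def by blast

lemma ext_space_alternating: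
  assumes "\<phi> \<in> dual_tuples n" "i < n" "j < n" "i \<noteq> j" "\<phi> i = \<phi> j"
  shows "\<omega> \<phi> = 0"
  using \<omega> assms unfolding ext_space_def by blast

lemma ext_space_summable:
  "(\<lambda>e. (norm (\<omega> (riesz n e)))\<^sup>2) summable_on basis_tuples n"
  using \<omega> unfolding ext_space_def by blast

lemma ext_space_bounded:
  obtains C where "\<And>\<phi>. \<phi> \<in> dual_tuples n \<Longrightarrow> norm (\<omega> \<phi>) \<le> C * (\<Prod>i<n. onorm (\<phi> i))"
  using \<omega> unfolding ext_space_def by blast

lemma ext_space_sum:
  assumes "\<phi> \<in> dual_tuples n" "i < n" "finite K" "\<And>k. k \<in> K \<Longrightarrow> bounded_clinear (\<psi> k)"
  shows "\<omega> (\<phi>(i := (\<lambda>x. \<Sum>k\<in>K. c k * \<psi> k x))) = (\<Sum>k\<in>K. c k * \<omega> (\<phi>(i := \<psi> k)))"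
  using assms(3,4)
proof (induction K)
  case empty
  show ?case
    \<comment> \<open>Linearity with both coefficients 0 says that a form vanishes when one slot is
      the zero functional.\<close>
    using ext_space_lincomb[OF assms(1,2), of "\<lambda>_. 0" "\<lambda>_. 0" 0 0]
    by (simp add: bounded_clinear_def scaleC_complex_def del: fun_upd_apply)
next
  case (insert k K)
  have "\<omega> (\<phi>(i := (\<lambda>x. c k * \<psi> k x + 1 * (\<Sum>k\<in>K. c k * \<psi> k x)))) =
      c k * \<omega> (\<phi>(i := \<psi> k)) + 1 * \<omega> (\<phi>(i := (\<lambda>x. \<Sum>k\<in>K. c k * \<psi> k x)))"
    by (rule ext_space_lincomb[OF assms(1,2)]) (use insert in \<open>auto intro: bounded_clinear_sum\<close>)
  then show ?case using insert by (simp del: fun_upd_apply)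
qed

text \<open>Induction on the number \<open>j\<close> of slots already expanded; each step applies
  \<open>ext_space_sum\<close> to slot \<open>j\<close>.\<close>

lemma ext_space_expand:
  assumes K: "finite K" "\<And>k. k \<in> K \<Longrightarrow> bounded_clinear (\<psi> k)"
  shows "\<omega> (\<lambda>i\<in>{..<n}. \<lambda>x. \<Sum>k\<in>K. c i k * \<psi> k x) =
    (\<Sum>\<kappa>\<in>{..<n} \<rightarrow>\<^sub>E K. (\<Prod>i<n. c i (\<kappa> i)) * \<omega> (\<lambda>i\<in>{..<n}. \<psi> (\<kappa> i)))"
proof -
  define L where "L i x = (\<Sum>k\<in>K. c i k * \<psi> k x)" for i x
  have L: "bounded_clinear (L i)" for i
    unfolding L_def by (rule bounded_clinear_sum) (use K in auto)
  have "\<omega> (\<lambda>i\<in>{..<n}. L i) = (\<Sum>\<kappa>\<in>{..<j} \<rightarrow>\<^sub>E K. (\<Prod>i<j. c i (\<kappa> i)) *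
      \<omega> (\<lambda>i\<in>{..<n}. if i < j then \<psi> (\<kappa> i) else L i))" if "j \<le> n" for j
    using that
  proof (induction j)
    case 0
    then show ?case by simp
  next
    case (Suc j)
    have step: "\<omega> (\<lambda>i\<in>{..<n}. if i < j then \<psi> (\<kappa> i) else L i) =
        (\<Sum>k\<in>K. c j k * \<omega> (\<lambda>i\<in>{..<n}. if i < Suc j then \<psi> ((\<kappa>(j := k)) i) else L i))"
      if \<kappa>: "\<kappa> \<in> {..<j} \<rightarrow>\<^sub>E K" for \<kappa>
    proof -
      define \<phi> where "\<phi> = (\<lambda>i\<in>{..<n}. if i < j then \<psi> (\<kappa> i) else L i)"
      have \<phi>: "\<phi> \<in> dual_tuples n"
        unfolding \<phi>_def using \<kappa> K L by (intro dual_tuples_restrict) (auto simp: PiE_iff)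
      have "\<phi> = \<phi>(j := (\<lambda>x. \<Sum>k\<in>K. c j k * \<psi> k x))"
        using Suc.prems by (auto simp: \<phi>_def L_def fun_eq_iff)
      then have "\<omega> \<phi> = \<omega> (\<phi>(j := (\<lambda>x. \<Sum>k\<in>K. c j k * \<psi> k x)))" by simp
      also have "\<dots> = (\<Sum>k\<in>K. c j k * \<omega> (\<phi>(j := \<psi> k)))"
        using ext_space_sum[OF \<phi> _ K] Suc.prems by simp
      also have "\<dots> = (\<Sum>k\<in>K. c j k * \<omega> (\<lambda>i\<in>{..<n}. if i < Suc j then \<psi> ((\<kappa>(j := k)) i) else L i))"
      proof (intro sum.cong refl arg_cong2[where f = "(*)"] arg_cong[where f = \<omega>] ext)
        fix k i x
        show "(\<phi>(j := \<psi> k)) i x = (\<lambda>i\<in>{..<n}. if i < Suc j then \<psi> ((\<kappa>(j := k)) i) else L i) i x"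
          using Suc.prems by (auto simp: \<phi>_def)
      qed
      finally show ?thesis by (simp only: \<phi>_def)
    qed
    have PiE: "{..<Suc j} \<rightarrow>\<^sub>E K = (\<lambda>(k, \<kappa>). \<kappa>(j := k)) ` (K \<times> ({..<j} \<rightarrow>\<^sub>E K))"
      unfolding lessThan_Suc by (rule PiE_insert_eq)
    have "(\<Sum>\<kappa>\<in>{..<Suc j} \<rightarrow>\<^sub>E K. (\<Prod>i<Suc j. c i (\<kappa> i)) *
          \<omega> (\<lambda>i\<in>{..<n}. if i < Suc j then \<psi> (\<kappa> i) else L i)) =
        (\<Sum>(k, \<kappa>)\<in>K \<times> ({..<j} \<rightarrow>\<^sub>E K). (\<Prod>i<Suc j. c i ((\<kappa>(j := k)) i)) *
          \<omega> (\<lambda>i\<in>{..<n}. if i < Suc j then \<psi> ((\<kappa>(j := k)) i) else L i))"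
      unfolding PiE by (subst sum.reindex[OF inj_combinator]) (auto simp: case_prod_unfold)
    also have "\<dots> = (\<Sum>\<kappa>\<in>{..<j} \<rightarrow>\<^sub>E K. \<Sum>k\<in>K. (\<Prod>i<j. c i (\<kappa> i)) * (c j k *
          \<omega> (\<lambda>i\<in>{..<n}. if i < Suc j then \<psi> ((\<kappa>(j := k)) i) else L i)))"
      unfolding sum.cartesian_product[symmetric] by (subst sum.swap) (simp add: mult.assoc)
    also have "\<dots> = (\<Sum>\<kappa>\<in>{..<j} \<rightarrow>\<^sub>E K. (\<Prod>i<j. c i (\<kappa> i)) *
        \<omega> (\<lambda>i\<in>{..<n}. if i < j then \<psi> (\<kappa> i) else L i))"
      by (intro sum.cong refl) (simp only: step sum_distrib_left)
    finally have *: "(\<Sum>\<kappa>\<in>{..<Suc j} \<rightarrow>\<^sub>E K. (\<Prod>i<Suc j. c i (\<kappa> i)) *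
          \<omega> (\<lambda>i\<in>{..<n}. if i < Suc j then \<psi> (\<kappa> i) else L i)) = \<dots>" .
    show ?case
      by (rule trans[OF Suc.IH *[symmetric]]) (use Suc.prems in simp)
  qed
  from this[of n] have "\<omega> (\<lambda>i\<in>{..<n}. L i) = (\<Sum>\<kappa>\<in>{..<n} \<rightarrow>\<^sub>E K. (\<Prod>i<n. c i (\<kappa> i)) *
      \<omega> (\<lambda>i\<in>{..<n}. if i < n then \<psi> (\<kappa> i) else L i))" by simp
  moreover have "(\<lambda>i\<in>{..<n}. if i < n then \<psi> (\<kappa> i) else L i) = (\<lambda>i\<in>{..<n}. \<psi> (\<kappa> i))" for \<kappa>
    by (auto simp: fun_eq_iff)
  ultimately show ?thesis unfolding L_def[abs_def] by (simp only:)
qed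

text \<open>The slots are exchanged one at a time. Each exchange changes the value by
  \<open>\<omega>\<close> of a tuple with a difference in one slot, which boundedness makes
  small.\<close>

lemma ext_space_tendsto:
  assumes \<phi>: "\<phi> \<in> dual_tuples n" and \<Phi>: "\<And>N. \<Phi> N \<in> dual_tuples n"
    and lim: "\<And>i. i < n \<Longrightarrow> ((\<lambda>N. onorm (\<lambda>x. \<Phi> N i x - \<phi> i x)) \<longlongrightarrow> 0) F"
  shows "((\<lambda>N. \<omega> (\<Phi> N)) \<longlongrightarrow> \<omega> \<phi>) F"
proof -
  obtain C where C: "\<And>\<phi>. \<phi> \<in> dual_tuples n \<Longrightarrow> norm (\<omega> \<phi>) \<le> C * (\<Prod>i<n. onorm (\<phi> i))"
    by (rule ext_space_bounded) (rule that)
  have bcl: "bounded_clinear (\<phi> i)" "bounded_clinear (\<Phi> N i)" if "i < n" for i N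
    using \<phi> \<Phi>[of N] that by (auto simp: dual_tuples_def PiE_iff)
  have bl: "bounded_linear (\<phi> i)" "bounded_linear (\<Phi> N i)" if "i < n" for i N
    using bcl[OF that] by (auto simp: bounded_clinear_def)
  have onorm_lim: "((\<lambda>N. onorm (\<Phi> N i)) \<longlongrightarrow> onorm (\<phi> i)) F" if i: "i < n" for i
  proof (rule LIM_zero_cancel, rule Lim_null_comparison[OF _ lim[OF i]])
    have "\<bar>onorm (\<Phi> N i) - onorm (\<phi> i)\<bar> \<le> onorm (\<lambda>x. \<Phi> N i x - \<phi> i x)" for N
    proof -
      have d: "bounded_linear (\<lambda>x. \<Phi> N i x - \<phi> i x)" "bounded_linear (\<lambda>x. \<phi> i x - \<Phi> N i x)"
        using bl[OF i] by (auto intro: bounded_linear_sub)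
      have "onorm (\<lambda>x. \<phi> i x - \<Phi> N i x) = onorm (\<lambda>x. \<Phi> N i x - \<phi> i x)"
        using onorm_neg[of "\<lambda>x. \<Phi> N i x - \<phi> i x"] by simp
      then show ?thesis
        using onorm_triangle[OF d(1) bl(1)[OF i]] onorm_triangle[OF d(2) bl(2)[OF i, of N]] by simp
    qed
    then show "\<forall>\<^sub>F N in F. norm (onorm (\<Phi> N i) - onorm (\<phi> i)) \<le> onorm (\<lambda>x. \<Phi> N i x - \<phi> i x)"
      by simp
  qed
  \<comment> \<open>The first \<open>j\<close> slots come from \<open>\<Phi>\<close>, the others
    from \<open>\<phi>\<close>.\<close>
  define \<Psi> where "\<Psi> j N = (\<lambda>i\<in>{..<n}. if i < j then \<Phi> N i else \<phi> i)" for j :: nat and N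
  have \<Psi>: "\<Psi> j N \<in> dual_tuples n" for j N
    unfolding \<Psi>_def by (rule dual_tuples_restrict) (auto simp: bcl)
  have "((\<lambda>N. \<omega> (\<Psi> j N)) \<longlongrightarrow> \<omega> \<phi>) F" if "j \<le> n" for j
    using that
  proof (induction j)
    case 0
    have "\<Psi> 0 N = \<phi>" for N
      using \<phi> by (auto simp: \<Psi>_def dual_tuples_def PiE_iff extensional_def)
    then show ?case by simp
  next
    case (Suc j)
    then have j: "j < n" by simp
    define D where "D N = (\<Psi> j N)(j := (\<lambda>x. \<Phi> N j x - \<phi> j x))" for N
    have dcl: "bounded_clinear (\<lambda>x. \<Phi> N j x - \<phi> j x)" for N
      using bounded_clinear_lincomb[OF bcl(2)[OF j, of N] bcl(1)[OF j], of 1 "-1"] by simp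
    have diff: "\<omega> (\<Psi> (Suc j) N) - \<omega> (\<Psi> j N) = \<omega> (D N)" for N
    proof -
      have "\<Psi> (Suc j) N = (\<Psi> j N)(j := \<Phi> N j)" "\<Psi> j N = (\<Psi> j N)(j := \<phi> j)"
        using j by (auto simp: \<Psi>_def)
      then show ?thesis
        using ext_space_lincomb[OF \<Psi>[of j N] j bcl(2)[OF j, of N] bcl(1)[OF j], of 1 "-1"]
        by (simp add: D_def)
    qed
    \<comment> \<open>Slot \<open>j\<close> contributes a factor tending to 0, while all other
      factors converge.\<close>
    have "((\<lambda>N. C * (\<Prod>i<n. onorm (D N i))) \<longlongrightarrow> C * (\<Prod>i<n. if i = j then 0 else onorm (\<phi> i))) F"
    proof (intro tendsto_mult tendsto_const tendsto_prod)
      fix i assume "i \<in> {..<n}"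
      then show "((\<lambda>N. onorm (D N i)) \<longlongrightarrow> (if i = j then 0 else onorm (\<phi> i))) F"
        using lim[of j] onorm_lim[of i] j by (cases "i < j") (auto simp: D_def \<Psi>_def)
    qed
    also have "(\<Prod>i<n. if i = j then 0 else onorm (\<phi> i)) = 0"
      using j by (intro prod_zero) auto
    finally have "((\<lambda>N. C * (\<Prod>i<n. onorm (D N i))) \<longlongrightarrow> 0) F" by simp
    then have "((\<lambda>N. \<omega> (D N)) \<longlongrightarrow> 0) F"
      by (rule Lim_null_comparison[rotated])
        (unfold D_def, intro always_eventually allI C dual_tuples_upd \<Psi> j dcl)
    then have "((\<lambda>N. \<omega> (\<Psi> j N) + \<omega> (D N)) \<longlongrightarrow> \<omega> \<phi> + 0) F"
      using Suc by (intro tendsto_add) auto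
    then show ?case by (simp flip: diff)
  qed
  from this[of n] have "((\<lambda>N. \<omega> (\<Psi> n N)) \<longlongrightarrow> \<omega> \<phi>) F" by simp
  moreover have "\<Psi> n N = \<Phi> N" for N
    using \<Phi>[of N] by (auto simp: \<Psi>_def dual_tuples_def PiE_iff extensional_def)
  ultimately show ?thesis by simp
qed

end

section \<open>Bessel's inequality in the exterior power\<close>

lemma norm_sum_mult_le:
  fixes a b :: "'i \<Rightarrow> complex"
  shows "(norm (\<Sum>i\<in>I. a i * b i))\<^sup>2 \<le> (\<Sum>i\<in>I. (norm (a i))\<^sup>2) * (\<Sum>i\<in>I. (norm (b i))\<^sup>2)"
proof -
  have "norm (\<Sum>i\<in>I. a i * b i) \<le> (\<Sum>i\<in>I. norm (a i) * norm (b i))"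
    by (rule order_trans[OF norm_sum]) (simp add: norm_mult)
  then have "(norm (\<Sum>i\<in>I. a i * b i))\<^sup>2 \<le> (\<Sum>i\<in>I. norm (a i) * norm (b i))\<^sup>2"
    by (rule power_mono) simp
  also have "\<dots> \<le> (\<Sum>i\<in>I. (norm (a i))\<^sup>2) * (\<Sum>i\<in>I. (norm (b i))\<^sup>2)"
    by (rule Cauchy_Schwarz_ineq_sum)
  finally show ?thesis .
qed

text \<open>Square summability of both forms gives absolute convergence; \<open>fact n\<close>
  undoes the normalisation of \<open>ext_inner\<close>.\<close>

lemma has_sum_ext_inner:
  assumes "\<omega> \<in> ext_space n" "\<eta> \<in> ext_space n"
  shows "((\<lambda>e. cnj (\<omega> (riesz n e)) * \<eta> (riesz n e)) has_sum fact n * ext_inner n \<omega> \<eta>) (basis_tuples n)"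
proof -
  have "(\<lambda>e. (norm (\<omega> (riesz n e)))\<^sup>2 + (norm (\<eta> (riesz n e)))\<^sup>2) summable_on basis_tuples n"
    using assms by (intro summable_on_add ext_space_summable)
  then have "(\<lambda>e. norm (cnj (\<omega> (riesz n e)) * \<eta> (riesz n e))) summable_on basis_tuples n"
  proof (rule summable_on_comparison_test)
    fix e
    show "norm (cnj (\<omega> (riesz n e)) * \<eta> (riesz n e)) \<le> (norm (\<omega> (riesz n e)))\<^sup>2 + (norm (\<eta> (riesz n e)))\<^sup>2"
    proof -
      have "2 * norm (\<omega> (riesz n e)) * norm (\<eta> (riesz n e)) \<le> (norm (\<omega> (riesz n e)))\<^sup>2 + (norm (\<eta> (riesz n e)))\<^sup>2"
        by (rule sum_squares_bound)
      moreover have "0 \<le> norm (\<omega> (riesz n e)) * norm (\<eta> (riesz n e))" by simp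
      ultimately show ?thesis unfolding norm_mult complex_mod_cnj by linarith
    qed
  qed auto
  then have "(\<lambda>e. cnj (\<omega> (riesz n e)) * \<eta> (riesz n e)) summable_on basis_tuples n"
    by (rule abs_summable_summable)
  then show ?thesis
    using has_sum_infsum by (simp add: ext_inner_def)
qed

definition span_proj :: "'a::complex_hilbert set \<Rightarrow> 'a \<Rightarrow> 'a" where
  "span_proj E x = (\<Sum>e\<in>E. cinner e x *\<^sub>C e)"

text \<open>Projecting onto a finite span keeps the multilinear expansion finite. The conjugates
  arise because \<open>riesz\<close> is antilinear in the vectors.\<close>

lemma ext_space_span_proj:
  assumes "\<omega> \<in> ext_space n" "finite E"
  shows "\<omega> (riesz n (\<lambda>i. span_proj E (x i))) =
    (\<Sum>\<kappa>\<in>{..<n} \<rightarrow>\<^sub>E E. (\<Prod>i<n. cnj (cinner (\<kappa> i) (x i))) * \<omega> (riesz n \<kappa>))"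
proof -
  have "riesz n (\<lambda>i. span_proj E (x i)) = (\<lambda>i\<in>{..<n}. \<lambda>y. \<Sum>e\<in>E. cnj (cinner e (x i)) * cinner e y)"
    by (auto simp: riesz_def span_proj_def fun_eq_iff cinner_sum_left cinner_scaleC_left)
  then show ?thesis
    using ext_space_expand[OF assms(1,2), of cinner "\<lambda>i e. cnj (cinner e (x i))"]
    by (simp add: bounded_clinear_cinner riesz_def)
qed

text \<open>The sharp constant is \<open>1\<close> (Hadamard's inequality), but \<open>n!\<close> is enough below, since only
  tuples of distinct indices contribute to the trace.\<close>

lemma ext_bessel_span_proj:
  fixes x :: "nat \<Rightarrow> 'a::complex_hilbert"
  assumes F: "finite F" "orthonormal (ext_space n) (ext_inner n) F"
    and E: "finite E" "E \<subseteq> some_basis UNIV cinner"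
  shows "(\<Sum>b\<in>F. (norm (b (riesz n (\<lambda>i. span_proj E (x i)))))\<^sup>2) \<le> fact n * (\<Prod>i<n. (norm (x i))\<^sup>2)"
proof -
  define y where "y b = b (riesz n (\<lambda>i. span_proj E (x i)))" for b :: "(nat \<Rightarrow> 'a \<Rightarrow> complex) \<Rightarrow> complex"
  define X where "X = (\<Sum>b\<in>F. (norm (y b))\<^sup>2)"
  define c where "c \<kappa> = (\<Prod>i<n. cnj (cinner (\<kappa> i) (x i)))" for \<kappa> :: "nat \<Rightarrow> 'a"
  \<comment> \<open>These weights turn \<open>X\<close> into a pairing of \<open>c\<close> with the
    values of \<open>\<omega>\<close>. Cauchy-Schwarz then bounds the square of \<open>X\<close> by
    a multiple of \<open>X\<close> itself.\<close>
  define \<omega> where "\<omega> e = (\<Sum>b\<in>F. cnj (y b) * b (riesz n e))" for e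
  have Fe: "b \<in> ext_space n" if "b \<in> F" for b
    using F that by (auto simp: orthonormal_def)
  have on: "orthonormal UNIV cinner (some_basis UNIV (cinner :: 'a \<Rightarrow> _))"
    using orthonormal_basis_some[of UNIV "cinner :: 'a \<Rightarrow> _"] by (simp add: orthonormal_basis_def)
  have "of_real X = (\<Sum>b\<in>F. cnj (y b) * y b)"
    unfolding X_def of_real_sum complex_norm_square by (simp add: mult.commute)
  also have "\<dots> = (\<Sum>b\<in>F. cnj (y b) * (\<Sum>\<kappa>\<in>{..<n} \<rightarrow>\<^sub>E E. c \<kappa> * b (riesz n \<kappa>)))"
    unfolding c_def y_def[of "b" for b] using ext_space_span_proj[OF Fe E(1), of _ x]
    by (intro sum.cong) auto
  also have "\<dots> = (\<Sum>\<kappa>\<in>{..<n} \<rightarrow>\<^sub>E E. c \<kappa> * \<omega> \<kappa>)"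
    unfolding \<omega>_def sum_distrib_left by (subst sum.swap) (simp add: mult_ac)
  finally have X: "complex_of_real X = (\<Sum>\<kappa>\<in>{..<n} \<rightarrow>\<^sub>E E. c \<kappa> * \<omega> \<kappa>)" .
  have "(norm (complex_of_real X))\<^sup>2 \<le>
      (\<Sum>\<kappa>\<in>{..<n} \<rightarrow>\<^sub>E E. (norm (c \<kappa>))\<^sup>2) * (\<Sum>\<kappa>\<in>{..<n} \<rightarrow>\<^sub>E E. (norm (\<omega> \<kappa>))\<^sup>2)"
    unfolding X by (rule norm_sum_mult_le)
  also have "\<dots> \<le> (\<Prod>i<n. (norm (x i))\<^sup>2) * (fact n * X)"
  proof (rule mult_mono)
    \<comment> \<open>The sum over the cube factors into one Bessel sum per slot.\<close>
    have "(\<Sum>\<kappa>\<in>{..<n} \<rightarrow>\<^sub>E E. (norm (c \<kappa>))\<^sup>2) = (\<Prod>i<n. \<Sum>e\<in>E. (norm (cinner e (x i)))\<^sup>2)"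
      using E(1) by (subst prod_sum_PiE) (auto simp: c_def prod_power_distrib simp flip: prod_norm)
    also have "\<dots> \<le> (\<Prod>i<n. (norm (x i))\<^sup>2)"
      using Bessel[OF on E(2,1)] by (intro prod_mono) (auto intro: sum_nonneg)
    finally show "(\<Sum>\<kappa>\<in>{..<n} \<rightarrow>\<^sub>E E. (norm (c \<kappa>))\<^sup>2) \<le> (\<Prod>i<n. (norm (x i))\<^sup>2)" .
    \<comment> \<open>By orthonormality of \<open>F\<close> the squares of \<open>\<omega>\<close>
      over all basis tuples add up to \<open>fact n * X\<close>; the cube is a finite part of that
      sum.\<close>
    have "((\<lambda>e. \<Sum>b\<in>F. \<Sum>b'\<in>F. (y b * cnj (y b')) * (cnj (b (riesz n e)) * b' (riesz n e))) has_sum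
        (\<Sum>b\<in>F. \<Sum>b'\<in>F. (y b * cnj (y b')) * (fact n * ext_inner n b b'))) (basis_tuples n)"
      using F(1) Fe by (intro has_sum_finite_sum has_sum_cmult_right has_sum_ext_inner) auto
    also have "(\<lambda>e. \<Sum>b\<in>F. \<Sum>b'\<in>F. (y b * cnj (y b')) * (cnj (b (riesz n e)) * b' (riesz n e))) =
        (\<lambda>e. of_real ((norm (\<omega> e))\<^sup>2))"
    proof
      fix e
      show "(\<Sum>b\<in>F. \<Sum>b'\<in>F. (y b * cnj (y b')) * (cnj (b (riesz n e)) * b' (riesz n e))) = of_real ((norm (\<omega> e))\<^sup>2)"
      proof -
        have "of_real ((norm (\<omega> e))\<^sup>2) = cnj (\<omega> e) * \<omega> e"
          by (simp only: complex_norm_square mult.commute)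
        also have "\<dots> = (\<Sum>b\<in>F. \<Sum>b'\<in>F. (y b * cnj (b (riesz n e))) * (cnj (y b') * b' (riesz n e)))"
          unfolding \<omega>_def cnj_sum sum_product by simp
        finally show ?thesis by (simp only: mult_ac)
      qed
    qed
    also have "(\<Sum>b\<in>F. \<Sum>b'\<in>F. (y b * cnj (y b')) * (fact n * ext_inner n b b')) =
        (\<Sum>b\<in>F. \<Sum>b'\<in>F. if b = b' then fact n * (y b * cnj (y b')) else 0)"
      using F(2) by (intro sum.cong refl) (simp add: orthonormal_def)
    also have "\<dots> = of_real (fact n * X)"
      using F(1) unfolding X_def of_real_mult of_real_sum complex_norm_square
      by (simp add: sum_distrib_left)
    finally have "((\<lambda>e. (norm (\<omega> e))\<^sup>2) has_sum fact n * X) (basis_tuples n)"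
      by (rule has_sum_of_real_iff[THEN iffD1])
    then show "(\<Sum>\<kappa>\<in>{..<n} \<rightarrow>\<^sub>E E. (norm (\<omega> \<kappa>))\<^sup>2) \<le> fact n * X"
      by (rule finite_sum_le_has_sum)
        (use E in \<open>auto intro!: finite_PiE simp: basis_tuples_def PiE_iff\<close>)
  qed (auto intro: prod_nonneg sum_nonneg)
  finally have le: "X * X \<le> (fact n * (\<Prod>i<n. (norm (x i))\<^sup>2)) * X"
    by (simp add: power2_eq_square mult_ac)
  have "X \<ge> 0" by (simp add: X_def sum_nonneg)
  then have "X \<le> fact n * (\<Prod>i<n. (norm (x i))\<^sup>2)"
    using le by (cases "X = 0") (auto intro!: mult_nonneg_nonneg prod_nonneg)
  then show ?thesis by (simp add: X_def y_def)
qed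

text \<open>Along the finite parts \<open>E\<close> of the basis the projections converge to the
  \<open>x i\<close>; forms are continuous and the bound for projections does not depend on
  \<open>E\<close>.\<close>

lemma ext_bessel:
  fixes x :: "nat \<Rightarrow> 'a::complex_hilbert"
  assumes F: "finite F" "orthonormal (ext_space n) (ext_inner n) F"
  shows "(\<Sum>b\<in>F. (norm (b (riesz n x)))\<^sup>2) \<le> fact n * (\<Prod>i<n. (norm (x i))\<^sup>2)"
proof -
  define G where "G = finite_subsets_at_top (some_basis UNIV (cinner :: 'a \<Rightarrow> _))"
  define y where "y E i = span_proj E (x i)" for E i
  have onorm_lim: "((\<lambda>E. onorm (\<lambda>z. riesz n (y E) i z - riesz n x i z)) \<longlongrightarrow> 0) G" if i: "i < n" for i
  proof (rule Lim_null_comparison)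
    have "((\<lambda>E. y E i) \<longlongrightarrow> x i) G"
      using basis_expansion[OF orthonormal_basis_some, of "x i"]
      by (simp add: has_sum_def span_proj_def y_def G_def)
    then show "((\<lambda>E. norm (y E i - x i)) \<longlongrightarrow> 0) G"
      by (simp add: LIM_zero tendsto_norm_zero)
    have "norm (onorm (\<lambda>z. riesz n (y E) i z - riesz n x i z)) \<le> norm (y E i - x i)" for E
    proof -
      have eq: "(\<lambda>z. riesz n (y E) i z - riesz n x i z) = cinner (y E i - x i)"
        using i by (auto simp: riesz_def cinner_diff_left)
      have "0 \<le> onorm (cinner (y E i - x i))"
        by (rule onorm_pos_le[OF bounded_linear_cinner])
      moreover have "onorm (cinner (y E i - x i)) \<le> norm (y E i - x i)"
        by (rule onorm_bound) (auto intro: cinner_Cauchy_Schwarz)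
      ultimately show ?thesis unfolding eq by simp
    qed
    then show "\<forall>\<^sub>F E in G. norm (onorm (\<lambda>z. riesz n (y E) i z - riesz n x i z)) \<le> norm (y E i - x i)"
      by simp
  qed
  have "((\<lambda>E. b (riesz n (y E))) \<longlongrightarrow> b (riesz n x)) G" if "b \<in> F" for b
    by (rule ext_space_tendsto[OF _ riesz_in_dual_tuples riesz_in_dual_tuples onorm_lim])
      (use F that in \<open>auto simp: orthonormal_def\<close>)
  then have lim: "((\<lambda>E. \<Sum>b\<in>F. (norm (b (riesz n (y E))))\<^sup>2) \<longlongrightarrow> (\<Sum>b\<in>F. (norm (b (riesz n x)))\<^sup>2)) G"
    by (intro tendsto_sum tendsto_power tendsto_norm)
  have "\<forall>\<^sub>F E in G. (\<Sum>b\<in>F. (norm (b (riesz n (y E))))\<^sup>2) \<le> fact n * (\<Prod>i<n. (norm (x i))\<^sup>2)"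
    unfolding G_def y_def
    by (rule eventually_finite_subsets_at_top_weakI) (rule ext_bessel_span_proj[OF F])
  then show ?thesis
    by (rule tendsto_upperbound[OF lim]) (simp add: G_def)
qed

subsection \<open>Decay of the traces of the exterior powers\<close>

text \<open>Sums over basis tuples will be controlled on cubes
  \<open>{..<n} \<rightarrow>\<^sub>E E\<close>. These are cofinal among the finite sets of tuples,
  which suffices for a bound on the limit.\<close>

lemma has_sum_norm_le_cofinal:
  fixes f :: "'i \<Rightarrow> 'b::real_normed_vector"
  assumes f: "(f has_sum L) I"
    and cofinal: "\<And>G. finite G \<Longrightarrow> G \<subseteq> I \<Longrightarrow> \<exists>G'. finite G' \<and> G \<subseteq> G' \<and> G' \<subseteq> I \<and> norm (sum f G') \<le> c"
  shows "norm L \<le> c"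
proof (rule field_le_epsilon)
  fix \<epsilon> :: real assume "\<epsilon> > 0"
  then have "\<forall>\<^sub>F G in finite_subsets_at_top I. dist (sum f G) L < \<epsilon>"
    using f unfolding has_sum_def by (rule tendstoD[rotated])
  then obtain G where G: "finite G" "G \<subseteq> I"
    and close: "\<And>G'. finite G' \<Longrightarrow> G \<subseteq> G' \<Longrightarrow> G' \<subseteq> I \<Longrightarrow> dist (sum f G') L < \<epsilon>"
    unfolding eventually_finite_subsets_at_top by auto
  obtain G' where G': "finite G'" "G \<subseteq> G'" "G' \<subseteq> I" "norm (sum f G') \<le> c"
    using cofinal[OF G] by blast
  show "norm L \<le> c + \<epsilon>"
    using close[OF G'(1-3)] G'(4) norm_triangle_ineq2[of L "sum f G'"]
    by (simp add: dist_norm norm_minus_commute)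
qed

text \<open>A family without a sum has \<open>infsum\<close> 0, hence the assumption
  \<open>c \<ge> 0\<close>.\<close>

lemma norm_infsum_le_cofinal:
  fixes f :: "'i \<Rightarrow> complex"
  assumes "c \<ge> 0" and "\<And>G. finite G \<Longrightarrow> G \<subseteq> I \<Longrightarrow> \<exists>G'. finite G' \<and> G \<subseteq> G' \<and> G' \<subseteq> I \<and> norm (sum f G') \<le> c"
  shows "norm (infsum f I) \<le> c"
proof (cases "f summable_on I")
  case True
  then show ?thesis using has_sum_norm_le_cofinal[OF has_sum_infsum] assms(2) by blast
qed (use assms(1) in \<open>simp add: infsum_not_exists\<close>)

text \<open>At most \<open>m\<close> of the distinct indices lie below \<open>m\<close>, so damping the first \<open>m\<close> weights by \<open>R\<close>
  costs no more than a factor \<open>R ^ m\<close>.\<close>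

lemma sum_inj_tuples_le:
  fixes t :: "nat \<Rightarrow> real"
  assumes t: "\<And>k. t k \<ge> 0" and R: "R \<ge> 1"
  shows "(\<Sum>\<kappa> | \<kappa> \<in> {..<n} \<rightarrow>\<^sub>E {..<N} \<and> inj_on \<kappa> {..<n}. \<Prod>i<n. t (\<kappa> i)) \<le>
    R ^ m * (\<Sum>k<N. if k < m then t k / R else t k) ^ n"
proof -
  define t' where "t' k = (if k < m then t k / R else t k)" for k
  have t': "t' k \<ge> 0" for k using t R by (simp add: t'_def)
  have fin: "finite ({..<n} \<rightarrow>\<^sub>E {..<N})" by (simp add: finite_PiE)
  have "(\<Prod>i<n. t (\<kappa> i)) \<le> R ^ m * (\<Prod>i<n. t' (\<kappa> i))" if inj: "inj_on \<kappa> {..<n}" for \<kappa>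
  proof -
    let ?J = "{i\<in>{..<n}. \<kappa> i < m}"
    have "(\<Prod>i<n. t (\<kappa> i)) = (\<Prod>i<n. (if \<kappa> i < m then R else 1) * t' (\<kappa> i))"
      using R by (intro prod.cong) (auto simp: t'_def)
    also have "\<dots> = R ^ card ?J * (\<Prod>i<n. t' (\<kappa> i))"
      by (simp add: prod.distrib flip: prod.inter_filter)
    also have "\<dots> \<le> R ^ m * (\<Prod>i<n. t' (\<kappa> i))"
    proof (intro mult_right_mono power_increasing prod_nonneg)
      have "card (\<kappa> ` ?J) = card ?J"
        by (rule card_image) (rule inj_on_subset[OF inj], auto)
      moreover have "card (\<kappa> ` ?J) \<le> card {..<m}"
        by (rule card_mono) auto
      ultimately show "card ?J \<le> m" by simp
    qed (use R t' in auto)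
    finally show ?thesis .
  qed
  then have "(\<Sum>\<kappa> | \<kappa> \<in> {..<n} \<rightarrow>\<^sub>E {..<N} \<and> inj_on \<kappa> {..<n}. \<Prod>i<n. t (\<kappa> i)) \<le>
      (\<Sum>\<kappa> | \<kappa> \<in> {..<n} \<rightarrow>\<^sub>E {..<N} \<and> inj_on \<kappa> {..<n}. R ^ m * (\<Prod>i<n. t' (\<kappa> i)))"
    by (intro sum_mono) auto
  \<comment> \<open>After the damping, injectivity is dropped so that the sum over all tuples
    factors into an \<open>n\<close>-th power.\<close>
  also have "\<dots> \<le> (\<Sum>\<kappa>\<in>{..<n} \<rightarrow>\<^sub>E {..<N}. R ^ m * (\<Prod>i<n. t' (\<kappa> i)))"
    using fin R t' by (intro sum_mono2) (auto intro!: mult_nonneg_nonneg prod_nonneg)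
  also have "\<dots> = R ^ m * (\<Prod>i<n. \<Sum>k<N. t' k)"
    by (subst prod_sum_PiE) (simp_all add: sum_distrib_left)
  finally show ?thesis by (simp add: t'_def)
qed

text \<open>\<open>m\<close> cuts off a tail below \<open>1 / 4\<close>, and \<open>R\<close> is
  large enough to damp the head to \<open>1 / 4\<close> as well.\<close>

lemma damped_sums_small:
  fixes t :: "nat \<Rightarrow> real"
  assumes t: "\<And>k. t k \<ge> 0" and sum: "summable t"
  shows "\<exists>m R. R \<ge> 1 \<and> (\<forall>N. (\<Sum>k<N. if k < m then t k / R else t k) \<le> 1 / 2)"
proof -
  obtain m where m: "\<And>N. norm (sum t {m..<N}) < 1 / 4"
    using summable_Cauchy[THEN iffD1, OF sum, rule_format, of "1 / 4"] by auto
  define R where "R = max 1 (4 * (\<Sum>k<m. t k))"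
  have R: "R \<ge> 1" "4 * (\<Sum>k<m. t k) \<le> R" by (auto simp: R_def)
  have "(\<Sum>k<N. if k < m then t k / R else t k) \<le> 1 / 2" for N
  proof -
    have "(\<Sum>k<N. if k < m then t k / R else t k) \<le> (\<Sum>k\<in>{..<m} \<union> {m..<N}. if k < m then t k / R else t k)"
      using t R by (intro sum_mono2) auto
    also have "\<dots> = (\<Sum>k<m. t k / R) + sum t {m..<N}"
      by (subst sum.union_disjoint) auto
    also have "(\<Sum>k<m. t k / R) \<le> 1 / 4"
      using R by (simp add: field_simps flip: sum_divide_distrib)
    also have "sum t {m..<N} \<le> 1 / 4"
      using m[of N] by simp
    finally show ?thesis by simp
  qed
  then show ?thesis using R(1) by blast
qed

text \<open>Multilinear expansion over index tuples \<open>\<kappa>\<close> separates the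
  \<open>w\<close> from the \<open>u\<close>, and summing over \<open>e\<close> reassembles the
  projected \<open>u\<close>. Tuples with a repeated index drop out by alternation; for the others
  Cauchy-Schwarz over \<open>F\<close> and Bessel on both sides leave a single
  \<open>fact n\<close>.\<close>

lemma ext_trace_finite_rank_bound:
  fixes u w :: "nat \<Rightarrow> 'a::complex_hilbert"
  assumes F: "finite F" "orthonormal (ext_space n) (ext_inner n) F"
    and E: "finite E" "E \<subseteq> some_basis UNIV cinner" and uw: "\<And>k. norm (u k) = norm (w k)"
  shows "norm (\<Sum>e\<in>{..<n} \<rightarrow>\<^sub>E E. \<Sum>b\<in>F. cnj (b (riesz n e)) *
      b (\<lambda>i\<in>{..<n}. \<lambda>x. \<Sum>k<N. cinner (e i) (u k) * cinner (w k) x)) \<le>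
    fact n * (\<Sum>\<kappa> | \<kappa> \<in> {..<n} \<rightarrow>\<^sub>E {..<N} \<and> inj_on \<kappa> {..<n}. \<Prod>i<n. (norm (w (\<kappa> i)))\<^sup>2)"
proof -
  define p where "p \<kappa> b = b (riesz n (\<lambda>i. w (\<kappa> i)))" for \<kappa> :: "nat \<Rightarrow> nat" and b :: "(nat \<Rightarrow> 'a \<Rightarrow> complex) \<Rightarrow> complex"
  define q where "q \<kappa> b = b (riesz n (\<lambda>i. span_proj E (u (\<kappa> i))))" for \<kappa> :: "nat \<Rightarrow> nat" and b :: "(nat \<Rightarrow> 'a \<Rightarrow> complex) \<Rightarrow> complex"
  have Fe: "b \<in> ext_space n" if "b \<in> F" for b
    using F that by (auto simp: orthonormal_def)
  have q: "cnj (q \<kappa> b) = (\<Sum>e\<in>{..<n} \<rightarrow>\<^sub>E E. (\<Prod>i<n. cinner (e i) (u (\<kappa> i))) * cnj (b (riesz n e)))"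
    if "b \<in> F" for \<kappa> b
    using ext_space_span_proj[OF Fe[OF that] E(1), of "\<lambda>i. u (\<kappa> i)"] by (simp add: q_def)
  have p0: "p \<kappa> b = 0" if b: "b \<in> F" and not_inj: "\<not> inj_on \<kappa> {..<n}" for \<kappa> b
  proof -
    obtain i j where "i < n" "j < n" "i \<noteq> j" "\<kappa> i = \<kappa> j"
      using not_inj by (auto simp: inj_on_def)
    then show ?thesis
      unfolding p_def by (intro ext_space_alternating[OF Fe[OF b] riesz_in_dual_tuples, of i j])
        (auto simp: riesz_def)
  qed
  have expand: "b (\<lambda>i\<in>{..<n}. \<lambda>x. \<Sum>k<N. cinner (e i) (u k) * cinner (w k) x) =
      (\<Sum>\<kappa>\<in>{..<n} \<rightarrow>\<^sub>E {..<N}. (\<Prod>i<n. cinner (e i) (u (\<kappa> i))) * p \<kappa> b)" if "b \<in> F" for b e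
    unfolding p_def riesz_def
    by (rule ext_space_expand[OF Fe[OF that] finite_lessThan]) (rule bounded_clinear_cinner)
  have "(\<Sum>e\<in>{..<n} \<rightarrow>\<^sub>E E. \<Sum>b\<in>F. cnj (b (riesz n e)) *
      b (\<lambda>i\<in>{..<n}. \<lambda>x. \<Sum>k<N. cinner (e i) (u k) * cinner (w k) x)) =
    (\<Sum>e\<in>{..<n} \<rightarrow>\<^sub>E E. \<Sum>b\<in>F. cnj (b (riesz n e)) *
      (\<Sum>\<kappa>\<in>{..<n} \<rightarrow>\<^sub>E {..<N}. (\<Prod>i<n. cinner (e i) (u (\<kappa> i))) * p \<kappa> b))"
    by (intro sum.cong refl) (simp add: expand)
  also have "\<dots> = (\<Sum>b\<in>F. \<Sum>\<kappa>\<in>{..<n} \<rightarrow>\<^sub>E {..<N}. \<Sum>e\<in>{..<n} \<rightarrow>\<^sub>E E.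
      p \<kappa> b * ((\<Prod>i<n. cinner (e i) (u (\<kappa> i))) * cnj (b (riesz n e))))"
    unfolding sum_distrib_left by (subst sum.swap, intro sum.cong refl, subst sum.swap) (simp add: mult_ac)
  also have "\<dots> = (\<Sum>\<kappa>\<in>{..<n} \<rightarrow>\<^sub>E {..<N}. \<Sum>b\<in>F. p \<kappa> b * cnj (q \<kappa> b))"
    by (subst sum.swap) (simp add: q sum_distrib_left)
  also have "\<dots> = (\<Sum>\<kappa> | \<kappa> \<in> {..<n} \<rightarrow>\<^sub>E {..<N} \<and> inj_on \<kappa> {..<n}. \<Sum>b\<in>F. p \<kappa> b * cnj (q \<kappa> b))"
    by (intro sum.mono_neutral_right) (auto simp: finite_PiE p0)
  also have "norm \<dots> \<le> (\<Sum>\<kappa> | \<kappa> \<in> {..<n} \<rightarrow>\<^sub>E {..<N} \<and> inj_on \<kappa> {..<n}. fact n * (\<Prod>i<n. (norm (w (\<kappa> i)))\<^sup>2))"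
  proof (rule sum_norm_le)
    fix \<kappa>
    let ?W = "fact n * (\<Prod>i<n. (norm (w (\<kappa> i)))\<^sup>2)"
    have W: "?W \<ge> 0" by (intro mult_nonneg_nonneg prod_nonneg) auto
    have "(norm (\<Sum>b\<in>F. p \<kappa> b * cnj (q \<kappa> b)))\<^sup>2 \<le>
        (\<Sum>b\<in>F. (norm (p \<kappa> b))\<^sup>2) * (\<Sum>b\<in>F. (norm (cnj (q \<kappa> b)))\<^sup>2)"
      by (rule norm_sum_mult_le)
    also have "\<dots> \<le> ?W * ?W"
    proof (rule mult_mono)
      show "(\<Sum>b\<in>F. (norm (p \<kappa> b))\<^sup>2) \<le> ?W"
        unfolding p_def by (rule ext_bessel[OF F])
      show "(\<Sum>b\<in>F. (norm (cnj (q \<kappa> b)))\<^sup>2) \<le> ?W"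
        using ext_bessel_span_proj[OF F E, of "\<lambda>i. u (\<kappa> i)"] by (simp add: q_def uw)
    qed (use W in \<open>auto intro: sum_nonneg\<close>)
    finally have "(norm (\<Sum>b\<in>F. p \<kappa> b * cnj (q \<kappa> b)))\<^sup>2 \<le> ?W\<^sup>2"
      by (simp add: power2_eq_square)
    then show "norm (\<Sum>b\<in>F. p \<kappa> b * cnj (q \<kappa> b)) \<le> ?W"
      using W by (rule power2_le_imp_le)
  qed
  finally show ?thesis by (simp add: sum_distrib_left)
qed

text \<open>The trace is truncated three times: to finitely many basis forms, to a cube of basis
  tuples and to finite rank \<open>N\<close>. The bound is uniform in all three, so every truncation
  can be removed.\<close>

lemma ext_trace_bound:
  fixes A :: "'a::complex_hilbert \<Rightarrow> 'a"
  assumes sep: "separable_space (euclidean :: 'a topology)" and A: "trace_class A"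
  shows "\<exists>C. \<forall>n. norm (ext_trace n A) \<le> C * (1 / 2) ^ n"
proof -
  obtain w u :: "nat \<Rightarrow> 'a" where uw: "\<And>k. norm (u k) = norm (w k)"
    and summ: "summable (\<lambda>k. (norm (w k))\<^sup>2)"
    and AN: "\<And>N. bounded_clinear (\<lambda>x. A x - (\<Sum>k<N. cinner (w k) x *\<^sub>C u k))"
    and AN0: "(\<lambda>N. onorm (\<lambda>x. A x - (\<Sum>k<N. cinner (w k) x *\<^sub>C u k))) \<longlonglongrightarrow> 0"
    by (rule nuclear_decomposition[OF sep A]) (rule that)
  have bA: "bounded_clinear A" using A by (simp add: trace_class_def)
  define t where "t k = (norm (w k))\<^sup>2" for k
  obtain m R where R: "R \<ge> 1" and half: "\<And>N. (\<Sum>k<N. if k < m then t k / R else t k) \<le> 1 / 2"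
    using damped_sums_small[of t, OF _ summ[folded t_def]] by (auto simp: t_def)
  have "norm (ext_trace n A) \<le> R ^ m * (1 / 2) ^ n" for n
  proof -
    define c where "c = R ^ m * (1 / 2) ^ n"
    define B where "B = some_basis (ext_space n :: ((nat \<Rightarrow> 'a \<Rightarrow> complex) \<Rightarrow> complex) set) (ext_inner n)"
    define T where "T = (basis_tuples n :: (nat \<Rightarrow> 'a) set)"
    define h where "h b e = cnj (b (riesz n e)) * ext_power n A b (riesz n e)"
      for b :: "(nat \<Rightarrow> 'a \<Rightarrow> complex) \<Rightarrow> complex" and e
    have c0: "c \<ge> 0" using R by (simp add: c_def)
    have "orthonormal_basis (ext_space n) (ext_inner n) B"
      unfolding B_def by (rule orthonormal_basis_some)
    then have B: "orthonormal (ext_space n) (ext_inner n) B"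
      by (simp add: orthonormal_basis_def)
    \<comment> \<open>For fixed \<open>F\<close> and \<open>E\<close> the sum is finite, so the rank
      can go to infinity by continuity of the forms.\<close>
    have cube: "norm (\<Sum>e\<in>{..<n} \<rightarrow>\<^sub>E E. \<Sum>b\<in>F. h b e) \<le> fact n * c"
      if F: "finite F" "F \<subseteq> B" and E: "finite E" "E \<subseteq> some_basis UNIV cinner" for F E
    proof -
      have onF: "orthonormal (ext_space n) (ext_inner n) F"
        using B F(2) unfolding orthonormal_def by (meson subset_iff)
      define \<Phi> where "\<Phi> e N = (\<lambda>i\<in>{..<n}. \<lambda>x. \<Sum>k<N. cinner (e i) (u k) * cinner (w k) x)"
        for e :: "nat \<Rightarrow> 'a" and N :: nat
      define \<phi> where "\<phi> e = (\<lambda>i\<in>{..<n}. cinner (e i) \<circ> A)" for e :: "nat \<Rightarrow> 'a"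
      have \<Phi>: "\<Phi> e N \<in> dual_tuples n" for e N
        unfolding \<Phi>_def by (intro dual_tuples_restrict bounded_clinear_sum) (auto simp: bounded_clinear_cinner)
      have \<phi>: "\<phi> e \<in> dual_tuples n" for e
        unfolding \<phi>_def by (intro dual_tuples_restrict bounded_clinear_compose bounded_clinear_cinner bA)
      have h: "h b e = cnj (b (riesz n e)) * b (\<phi> e)" for b e
      proof -
        have "(\<lambda>i\<in>{..<n}. riesz n e i \<circ> A) = \<phi> e"
          by (auto simp: \<phi>_def riesz_def fun_eq_iff)
        then show ?thesis by (simp add: h_def ext_power_def riesz_in_dual_tuples)
      qed
      have lim: "(\<lambda>N. b (\<Phi> e N)) \<longlonglongrightarrow> b (\<phi> e)" if "b \<in> F" for b e
      proof (rule ext_space_tendsto[OF _ \<phi> \<Phi>])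
        show "b \<in> ext_space n" using onF that by (auto simp: orthonormal_def)
        fix i assume i: "i < n"
        show "(\<lambda>N. onorm (\<lambda>x. \<Phi> e N i x - \<phi> e i x)) \<longlonglongrightarrow> 0"
        proof (rule Lim_null_comparison)
          let ?D = "\<lambda>N x. A x - (\<Sum>k<N. cinner (w k) x *\<^sub>C u k)"
          show "(\<lambda>N. norm (e i) * onorm (?D N)) \<longlonglongrightarrow> 0"
            using tendsto_mult_right_zero[OF AN0] by simp
          have "norm (onorm (\<lambda>x. \<Phi> e N i x - \<phi> e i x)) \<le> norm (e i) * onorm (?D N)" for N
          proof -
            have bl: "bounded_linear (?D N)" using AN by (simp add: bounded_clinear_def)
            have eq: "\<Phi> e N i x - \<phi> e i x = - cinner (e i) (?D N x)" for x
              using i by (simp add: \<Phi>_def \<phi>_def cinner_diff_right cinner_sum_right cinner_scaleC_right mult.commute)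
            have "0 \<le> onorm (\<lambda>x. \<Phi> e N i x - \<phi> e i x)"
              using \<Phi>[of e N] \<phi>[of e] i
              by (intro onorm_pos_le bounded_linear_sub) (auto simp: dual_tuples_def PiE_iff bounded_clinear_def)
            moreover have "onorm (\<lambda>x. \<Phi> e N i x - \<phi> e i x) \<le> norm (e i) * onorm (?D N)"
            proof (rule onorm_bound)
              show "0 \<le> norm (e i) * onorm (?D N)" using onorm_pos_le[OF bl] by simp
              fix x
              have "norm (cinner (e i) (?D N x)) \<le> norm (e i) * norm (?D N x)"
                by (rule cinner_Cauchy_Schwarz)
              also have "\<dots> \<le> norm (e i) * (onorm (?D N) * norm x)"
                by (intro mult_left_mono onorm[OF bl]) auto
              finally show "norm (\<Phi> e N i x - \<phi> e i x) \<le> norm (e i) * onorm (?D N) * norm x"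
                unfolding eq norm_minus_cancel by (simp only: mult.assoc)
            qed
            ultimately show ?thesis by simp
          qed
          then show "\<forall>\<^sub>F N in sequentially. norm (onorm (\<lambda>x. \<Phi> e N i x - \<phi> e i x)) \<le> norm (e i) * onorm (?D N)"
            by simp
        qed
      qed
      have "(\<lambda>N. norm (\<Sum>e\<in>{..<n} \<rightarrow>\<^sub>E E. \<Sum>b\<in>F. cnj (b (riesz n e)) * b (\<Phi> e N)))
          \<longlonglongrightarrow> norm (\<Sum>e\<in>{..<n} \<rightarrow>\<^sub>E E. \<Sum>b\<in>F. h b e)"
        unfolding h by (intro tendsto_norm tendsto_sum tendsto_mult tendsto_const lim)
      moreover have "norm (\<Sum>e\<in>{..<n} \<rightarrow>\<^sub>E E. \<Sum>b\<in>F. cnj (b (riesz n e)) * b (\<Phi> e N)) \<le> fact n * c" for N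
      proof -
        have "norm (\<Sum>e\<in>{..<n} \<rightarrow>\<^sub>E E. \<Sum>b\<in>F. cnj (b (riesz n e)) * b (\<Phi> e N)) \<le>
            fact n * (\<Sum>\<kappa> | \<kappa> \<in> {..<n} \<rightarrow>\<^sub>E {..<N} \<and> inj_on \<kappa> {..<n}. \<Prod>i<n. t (\<kappa> i))"
          unfolding \<Phi>_def t_def by (rule ext_trace_finite_rank_bound[OF F(1) onF E uw])
        also have "\<dots> \<le> fact n * (R ^ m * (\<Sum>k<N. if k < m then t k / R else t k) ^ n)"
          using R by (intro mult_left_mono sum_inj_tuples_le) (auto simp: t_def)
        also have "\<dots> \<le> fact n * c"
          unfolding c_def using R half
          by (intro mult_left_mono power_mono) (auto intro!: sum_nonneg simp: t_def)
        finally show ?thesis .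
      qed
      ultimately show ?thesis
        by (intro LIMSEQ_le_const2) auto
    qed
    have "norm (infsum (\<lambda>b. ext_inner n b (ext_power n A b)) B) \<le> c"
    proof (rule norm_infsum_le_cofinal[OF c0])
      fix F assume F: "finite F" "F \<subseteq> B"
      \<comment> \<open>Forms \<open>b\<close> with \<open>h b\<close> not summable have
        \<open>infsum\<close> 0; leaving them out turns the rest into a genuine convergent
        sum.\<close>
      define F' where "F' = {b\<in>F. h b summable_on T}"
      have F': "finite F'" "F' \<subseteq> B" using F by (auto simp: F'_def)
      have "((\<lambda>e. \<Sum>b\<in>F'. h b e) has_sum (\<Sum>b\<in>F'. infsum (h b) T)) T"
        using F'(1) by (intro has_sum_finite_sum) (auto simp: F'_def)
      then have "norm (\<Sum>b\<in>F'. infsum (h b) T) \<le> fact n * c"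
      proof (rule has_sum_norm_le_cofinal)
        fix G assume G: "finite G" "G \<subseteq> T"
        \<comment> \<open>All entries of tuples in \<open>G\<close>, so the cube over
          \<open>?E\<close> contains \<open>G\<close>.\<close>
        let ?E = "\<Union>e\<in>G. e ` {..<n}"
        have E: "finite ?E" "?E \<subseteq> some_basis UNIV cinner" "G \<subseteq> {..<n} \<rightarrow>\<^sub>E ?E"
          using G by (auto simp: T_def basis_tuples_def PiE_iff subset_iff)
        then have "finite ({..<n} \<rightarrow>\<^sub>E ?E)" "{..<n} \<rightarrow>\<^sub>E ?E \<subseteq> T"
          by (auto simp: T_def basis_tuples_def intro!: finite_PiE PiE_mono)
        then show "\<exists>G'. finite G' \<and> G \<subseteq> G' \<and> G' \<subseteq> T \<and> norm (\<Sum>e\<in>G'. \<Sum>b\<in>F'. h b e) \<le> fact n * c"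
          using cube[OF F' E(1,2)] E(3) by blast
      qed
      also have "(\<Sum>b\<in>F'. infsum (h b) T) = (\<Sum>b\<in>F. infsum (h b) T)"
        using F(1) by (intro sum.mono_neutral_left) (auto simp: F'_def infsum_not_exists)
      \<comment> \<open>The normalisation of \<open>ext_inner\<close> cancels the
        \<open>fact n\<close> from the Bessel estimates.\<close>
      also have "\<dots> = fact n * (\<Sum>b\<in>F. ext_inner n b (ext_power n A b))"
        by (simp add: ext_inner_def h_def[abs_def] T_def sum_divide_distrib[symmetric])
      finally have "norm (\<Sum>b\<in>F. ext_inner n b (ext_power n A b)) \<le> c"
        by (simp add: norm_mult)
      then show "\<exists>G'. finite G' \<and> F \<subseteq> G' \<and> G' \<subseteq> B \<and> norm (\<Sum>b\<in>G'. ext_inner n b (ext_power n A b)) \<le> c"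
        using F by blast
    qed
    then show ?thesis by (simp add: ext_trace_def op_trace_def B_def c_def)
  qed
  then show ?thesis by blast
qed

section \<open>The Fredholm function as a power series\<close>

lemma ext_trace_scale:
  fixes A :: "'a::complex_hilbert \<Rightarrow> 'a"
  assumes A: "bounded_clinear A"
  shows "ext_trace n (\<lambda>x. c *\<^sub>C A x) = c ^ n * ext_trace n A"
proof -
  have power: "ext_power n (\<lambda>x. c *\<^sub>C A x) \<omega> \<phi> = c ^ n * ext_power n A \<omega> \<phi>"
    if \<omega>: "\<omega> \<in> ext_space n" for \<omega> \<phi>
  proof (cases "\<phi> \<in> dual_tuples n")
    case True
    then have \<phi>: "bounded_clinear (\<phi> i)" if "i < n" for i
      using that by (auto simp: dual_tuples_def PiE_iff)
    \<comment> \<open>The first \<open>j\<close> slots carry the scalar \<open>c\<close>; passing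
      from \<open>j\<close> to \<open>Suc j\<close> pulls out one factor.\<close>
    define \<psi> where "\<psi> j = (\<lambda>i\<in>{..<n}. \<lambda>x. (if i < j then c else 1) * \<phi> i (A x))" for j
    have \<psi>: "\<psi> j \<in> dual_tuples n" for j
      unfolding \<psi>_def
    proof (rule dual_tuples_restrict)
      fix i assume "i < n"
      then have "bounded_clinear (\<phi> i \<circ> A)" using \<phi> A bounded_clinear_compose by blast
      then show "bounded_clinear (\<lambda>x. (if i < j then c else 1) * \<phi> i (A x))"
        using bounded_clinear_lincomb[of "\<phi> i \<circ> A" "\<phi> i \<circ> A" "if i < j then c else 1" 0] by simp
    qed
    have "\<omega> (\<psi> j) = c ^ j * \<omega> (\<psi> 0)" if "j \<le> n" for j
      using that
    proof (induction j)
      case (Suc j)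
      then have j: "j < n" by simp
      have bcl: "bounded_clinear (\<psi> j j)"
        using \<psi>[of j] j by (auto simp: dual_tuples_def PiE_iff)
      have "\<psi> (Suc j) = (\<psi> j)(j := (\<lambda>x. c * \<psi> j j x + 0 * \<psi> j j x))"
        using j by (auto simp: \<psi>_def fun_eq_iff)
      then have "\<omega> (\<psi> (Suc j)) = \<omega> ((\<psi> j)(j := (\<lambda>x. c * \<psi> j j x + 0 * \<psi> j j x)))" by (rule arg_cong)
      also have "\<dots> = c * \<omega> ((\<psi> j)(j := \<psi> j j)) + 0 * \<omega> ((\<psi> j)(j := \<psi> j j))"
        by (rule ext_space_lincomb[OF \<omega> \<psi>[of j] j bcl bcl])
      finally have "\<omega> (\<psi> (Suc j)) = c * \<omega> (\<psi> j)" by simp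
      then show ?case using Suc by simp
    qed simp
    from this[of n] have "\<omega> (\<psi> n) = c ^ n * \<omega> (\<psi> 0)" by simp
    moreover have "\<psi> n = (\<lambda>i\<in>{..<n}. \<phi> i \<circ> (\<lambda>x. c *\<^sub>C A x))"
      using \<phi> by (auto simp: \<psi>_def fun_eq_iff bounded_clinear_def scaleC_complex_def)
    moreover have "\<psi> 0 = (\<lambda>i\<in>{..<n}. \<phi> i \<circ> A)"
      by (auto simp: \<psi>_def fun_eq_iff)
    ultimately show ?thesis using True by (simp add: ext_power_def)
  qed (simp add: ext_power_def)
  have "op_trace (ext_space n) (ext_inner n) (ext_power n (\<lambda>x. c *\<^sub>C A x)) =
      (\<Sum>\<^sub>\<infinity>b\<in>some_basis (ext_space n) (ext_inner n). c ^ n * ext_inner n b (ext_power n A b))"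
    unfolding op_trace_def
  proof (rule infsum_cong)
    fix b :: "(nat \<Rightarrow> 'a \<Rightarrow> complex) \<Rightarrow> complex" assume "b \<in> some_basis (ext_space n) (ext_inner n)"
    then have "b \<in> ext_space n"
      using orthonormal_basis_some[of "ext_space n" "ext_inner n"]
      by (auto simp: orthonormal_basis_def orthonormal_def)
    then show "ext_inner n b (ext_power n (\<lambda>x. c *\<^sub>C A x) b) = c ^ n * ext_inner n b (ext_power n A b)"
      by (simp add: ext_inner_def power mult.left_commute[of _ "c ^ n"] infsum_cmult_right')
  qed
  then show ?thesis
    by (simp add: ext_trace_def op_trace_def infsum_cmult_right')
qed

text \<open>There is only one empty tuple, so the zeroth exterior power is one-dimensional and its
  operator is the identity.\<close>

lemma ext_trace_zero: "ext_trace 0 A = 1"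
proof -
  let ?K = "ext_space 0 :: ((nat \<Rightarrow> 'a \<Rightarrow> complex) \<Rightarrow> complex) set"
  let ?pt = "(\<lambda>_. undefined) :: nat \<Rightarrow> 'a \<Rightarrow> complex"
  define B where "B = some_basis ?K (ext_inner 0)"
  have B: "orthonormal ?K (ext_inner 0) B" "\<And>C. orthonormal ?K (ext_inner 0) C \<Longrightarrow> B \<subseteq> C \<Longrightarrow> C = B"
    using orthonormal_basis_some[of ?K "ext_inner 0"] by (auto simp: B_def orthonormal_basis_def)
  have inner: "ext_inner 0 a b = cnj (a ?pt) * b ?pt" for a b :: "(nat \<Rightarrow> 'a \<Rightarrow> complex) \<Rightarrow> complex"
    by (simp add: ext_inner_def basis_tuples_def riesz_def restrict_def)
  \<comment> \<open>The empty wedge is a unit vector, so maximality excludes the empty set.\<close>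
  have "B \<noteq> {}"
  proof
    assume "B = {}"
    have "orthonormal ?K (ext_inner 0) {wedge 0 undefined}"
      using wedge_in_ext_space[of 0 undefined] ext_inner_wedge[of 0 undefined undefined]
      by (simp add: orthonormal_def)
    then show False using B(2)[of "{wedge 0 undefined}"] \<open>B = {}\<close> by auto
  qed
  then obtain b where b: "b \<in> B" by blast
  have norm1: "cnj (b ?pt) * b ?pt = 1"
    using B(1) b by (auto simp: orthonormal_def inner)
  have "B = {b}"
  proof -
    have "a = b" if "a \<in> B" for a
    proof (rule ccontr)
      assume "a \<noteq> b"
      \<comment> \<open>Orthogonality here is a vanishing product of two scalars, impossible when
        both have modulus 1.\<close>
      then have "cnj (a ?pt) * b ?pt = 0" "cnj (a ?pt) * a ?pt = 1"
        using B(1) b that by (auto simp: orthonormal_def inner)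
      then show False using norm1 by auto
    qed
    then show ?thesis using b by blast
  qed
  moreover have "ext_power 0 A b ?pt = b ?pt"
    by (simp add: ext_power_def dual_tuples_def restrict_def)
  ultimately show ?thesis
    by (simp add: ext_trace_def op_trace_def B_def[symmetric] inner norm1)
qed

lemma scaleC_minus_left: "(- c) *\<^sub>C x = - (c *\<^sub>C x)" for x :: "'a::complex_hilbert"
  using scaleC_add_left[of "- c" c x] by (simp add: scaleC_zero_left add_eq_0_iff)

lemma fredholm_fun_power_series:
  fixes A :: "'a::complex_hilbert \<Rightarrow> 'a"
  assumes "bounded_clinear A"
  shows "fredholm_fun A z = (\<Sum>n. (- 1) ^ n * ext_trace n A * z ^ n)"
proof -
  have "(\<lambda>x. x - z *\<^sub>C A x - x) = (\<lambda>x. (- z) *\<^sub>C A x)"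
    by (simp add: scaleC_minus_left)
  then have "fredholm_fun A z = (\<Sum>n. (- z) ^ n * ext_trace n A)"
    by (simp add: fredholm_fun_def fredholm_det_def ext_trace_scale[OF assms])
  then show ?thesis
    by (simp add: power_minus[of z] mult_ac)
qed

text \<open>A quotient with \<open>1 < norm (a n)\<close> is negative and says nothing about \<open>a n\<close>; hence the
  assumption that \<open>a\<close> tends to \<open>0\<close>.\<close>

lemma coefficient_decay_of_limsup:
  fixes a :: "nat \<Rightarrow> complex"
  assumes a: "a \<longlonglongrightarrow> 0"
    and lim: "limsup (\<lambda>n. if a n = 0 then 0
      else ereal (real n * ln (real n) / (- ln (norm (a n))))) < ereal s"
  obtains \<rho> where "0 < \<rho>" "\<rho> < s"
    "\<forall>\<^sub>F n in sequentially. norm (a n) \<le> real n powr (- (real n / \<rho>))"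
proof -
  define X where "X n = (if a n = 0 then 0
      else ereal (real n * ln (real n) / (- ln (norm (a n)))))" for n
  have ev: "\<forall>\<^sub>F n in sequentially. norm (a n) < 1"
    using order_tendstoD(2)[OF tendsto_norm_zero[OF a], of 1] by simp
  \<comment> \<open>This makes the limsup nonnegative, so that a number strictly above it is a
    legitimate positive exponent.\<close>
  have "\<forall>\<^sub>F n in sequentially. 0 \<le> X n"
    using ev eventually_ge_at_top[of 1]
  proof eventually_elim
    case (elim n)
    show ?case
    proof (cases "a n = 0")
      case False
      then have "0 \<le> real n * ln (real n) / (- ln (norm (a n)))"
        using elim by (intro divide_nonneg_nonneg) auto
      then show ?thesis using False by (simp add: X_def)
    qed (simp add: X_def)
  qed
  then have "0 \<le> limsup X"
    by (intro le_Limsup) auto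
  moreover obtain r where r: "limsup X < r" "r < ereal s"
    using lim dense unfolding X_def by blast
  ultimately have "0 < r" by order
  then obtain \<rho> where \<rho>: "r = ereal \<rho>" "0 < \<rho>" "\<rho> < s"
    using r(2) by (cases r) auto
  have "\<forall>\<^sub>F n in sequentially. X n < ereal \<rho>"
    using Limsup_lessD r(1) \<rho>(1) by blast
  then have "\<forall>\<^sub>F n in sequentially. norm (a n) \<le> real n powr (- (real n / \<rho>))"
    using ev eventually_ge_at_top[of 1]
  proof eventually_elim
    case (elim n)
    show ?case
    proof (cases "a n = 0")
      case False
      then have ln: "- ln (norm (a n)) > 0" using elim(2) by simp
      have "real n * ln (real n) / (- ln (norm (a n))) < \<rho>"
        using elim(1) False by (simp add: X_def)
      \<comment> \<open>Clearing the denominator keeps the direction because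
        \<open>norm (a n) < 1\<close>.\<close>
      then have "real n * ln (real n) < \<rho> * (- ln (norm (a n)))"
        using ln by (simp only: pos_divide_less_eq)
      then have "ln (norm (a n)) \<le> - (real n / \<rho>) * ln (real n)"
        using \<rho>(2) by (simp add: field_simps)
      then have "exp (ln (norm (a n))) \<le> exp (- (real n / \<rho>) * ln (real n))"
        by (simp only: exp_le_cancel_iff)
      then show ?thesis
        using False elim(3) by (simp add: powr_def)
    qed simp
  qed
  then show thesis using that \<rho> by blast
qed

theorem theorem22:
  fixes A :: "'h::complex_hilbert \<Rightarrow> 'h" and s :: real
  assumes "separable_space (euclidean :: 'h topology)"
    and "trace_class A"
    and "ereal s > limsup (\<lambda>n. if ext_trace n A = 0 then 0
           else ereal (real n * ln (real n) / (- ln (norm (ext_trace n A)))))"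
  shows "(\<lambda>(z, k). 1 / norm z powr s) summable_on zeros_with_mult (fredholm_fun A)"
proof -
  \<comment> \<open>The signs leave the moduli unchanged, so decay of the traces is decay of the
    \<open>c n\<close>.\<close>
  define c where "c n = (- 1) ^ n * ext_trace n A" for n
  have f: "fredholm_fun A = (\<lambda>z. \<Sum>n. c n * z ^ n)"
    using fredholm_fun_power_series[of A] assms(2) by (auto simp: trace_class_def c_def)
  obtain C where C: "\<And>n. norm (ext_trace n A) \<le> C * (1 / 2) ^ n"
    using ext_trace_bound[OF assms(1,2)] by blast
  have "(\<lambda>n. C * (1 / 2) ^ n) \<longlonglongrightarrow> 0"
    by (intro tendsto_mult_right_zero LIMSEQ_realpow_zero) auto
  then have "(\<lambda>n. ext_trace n A) \<longlonglongrightarrow> 0"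
    by (rule Lim_null_comparison[rotated]) (simp add: C)
  then obtain \<rho> where \<rho>: "0 < \<rho>" "\<rho> < s"
    and decay: "\<forall>\<^sub>F n in sequentially. norm (ext_trace n A) \<le> real n powr (- (real n / \<rho>))"
    by (rule coefficient_decay_of_limsup[OF _ assms(3)])
  \<comment> \<open>Room on both sides: the growth estimate loses a little above
    \<open>\<rho>\<close>, and the dyadic summation needs an exponent below
    \<open>s\<close>.\<close>
  obtain \<rho>' where \<rho>': "\<rho> < \<rho>'" "\<rho>' < s" using dense[OF \<rho>(2)] by blast
  have decay': "\<forall>\<^sub>F n in sequentially. norm (c n) \<le> real n powr (- (real n / \<rho>))"
    using decay by (simp add: c_def norm_mult norm_power)
  note series = power_series_growth[OF \<rho>(1) \<rho>'(1) decay']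
  obtain K where K: "\<And>r z. r \<ge> 1 \<Longrightarrow> norm z = r \<Longrightarrow> norm (\<Sum>n. c n * z ^ n) \<le> exp (K * r powr \<rho>')"
    using series(2) by blast
  \<comment> \<open>Convergence at every point makes the series differentiable everywhere.\<close>
  have "(\<lambda>z. \<Sum>n. c n * z ^ n) holomorphic_on UNIV"
    unfolding holomorphic_on_def
    using termdiffs_strong_converges_everywhere[OF series(1)]
    by (auto simp: field_differentiable_def intro: has_field_derivative_at_within)
  moreover have "fredholm_fun A 0 = 1"
    by (simp add: f c_def ext_trace_zero)
  ultimately show ?thesis
    unfolding f using \<rho> \<rho>' K by (intro zeros_summable_of_growth[of _ \<rho>' s K]) auto
qed

end
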